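(* Let $A$ be a $C^*$-algebra, let $X$ be a Banach $A$-bimodule, and let $n\in\mathbb{N}$. Then every bounded local $n$-cocycle $T$ from $A^{(n)}$ into $X$ is an $n$-cocycle.
   Context: Let $A$ be a Banach algebra and $X$ a Banach $A$-bimodule. For $n\in\mathbb{N}=\{1,2,\dots\}$, $A^{(n)}$ is the Cartesian product of $n$ copies of $A$. For an $n$-linear map $T\colon A^{(n)}\to X$ define the $(n+1)$-linear map $\delta^nT\colon A^{(n+1)}\to X$ by $$\delta^nT(a_1,\ldots,a_{n+1})=a_1T(a_2,\ldots,a_{n+1})+\sum_{j=1}^n(-1)^jT(a_1,\ldots,a_{j-1},a_ja_{j+1},\ldots,a_{n+1})+(-1)^{n+1}T(a_1,\ldots,a_n)a_{n+1}.$$ $T$ is an $n$-cocycle if $\delta^nT=0$ (no boundedness is required). An $n$-linear map $T\colon A^{(n)}\to X$ is a local $n$-cocycle if for each $\tilde a=(a_1,\ldots,a_n)\in A^{(n)}$ there is an $n$-cocycle $T_{\tilde a}\colon A^{(n)}\to X$ (depending on $\tilde a$, not necessarily bounded) such that $T(\tilde a)=T_{\tilde a}(\tilde a)$. If in addition $T$ is bounded as an $n$-linear map, $T$ is a bounded local $n$-cocycle. *)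

theory Defs
  imports "HOL-Analysis.Analysis"
begin

class complex_normed_vector = real_normed_vector +
  fixes scaleC :: "complex \<Rightarrow> 'a \<Rightarrow> 'a" (infixr "*\<^sub>C" 75)
  assumes scaleC_add_right: "c *\<^sub>C (x + y) = c *\<^sub>C x + c *\<^sub>C y"
    and scaleC_add_left: "(c + d) *\<^sub>C x = c *\<^sub>C x + d *\<^sub>C x"
    and scaleC_scaleC: "c *\<^sub>C d *\<^sub>C x = (c * d) *\<^sub>C x"
    and scaleC_of_real: "complex_of_real r *\<^sub>C x = r *\<^sub>R x"
    and norm_scaleC: "norm (c *\<^sub>C x) = cmod c * norm x"

class complex_banach = complex_normed_vector + banach

text \<open>Neither a unit nor \<open>0 \<noteq> 1\<close> is required of a Banach algebra.\<close>

class complex_banach_algebra = complex_banach + real_normed_algebra +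
  assumes scaleC_mult_left: "(c *\<^sub>C x) * y = c *\<^sub>C (x * y)"
    and scaleC_mult_right: "x * (c *\<^sub>C y) = c *\<^sub>C (x * y)"

class cstar_algebra = complex_banach_algebra +
  fixes star :: "'a \<Rightarrow> 'a"
  assumes star_add: "star (x + y) = star x + star y"
    and star_scaleC: "star (c *\<^sub>C x) = cnj c *\<^sub>C star x"
    and star_mult: "star (x * y) = star y * star x"
    and star_star: "star (star x) = x"
    and cstar_identity: "norm (star x * x) = (norm x)\<^sup>2"

lemma vector_space_scaleC:
  "vector_space (scaleC :: complex \<Rightarrow> 'a \<Rightarrow> 'a::complex_normed_vector)"
proof
  show "1 *\<^sub>C x = x" for x :: 'a
    using scaleC_of_real[of 1 x] by simp
qed (simp_all add: scaleC_add_right scaleC_add_left scaleC_scaleC)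

abbreviation clinear ::
    "('a::complex_normed_vector \<Rightarrow> 'b::complex_normed_vector) \<Rightarrow> bool"
  where "clinear \<equiv> Vector_Spaces.linear scaleC scaleC"

text \<open>
  The actions are jointly continuous (\<open>norm (lact a x) \<le> K * norm a * norm x\<close> for some
  \<open>K\<close>, as provided by \<open>bounded_bilinear\<close>); \<open>K\<close> need not be 1, and the module need not be
  unital or essential.
\<close>

locale banach_bimodule =
  fixes lact :: "'a::complex_banach_algebra \<Rightarrow> 'x::complex_banach \<Rightarrow> 'x"
    and ract :: "'x \<Rightarrow> 'a \<Rightarrow> 'x"
  assumes bounded_bilinear_lact: "bounded_bilinear lact"
    and bounded_bilinear_ract: "bounded_bilinear ract"
    and clinear_lact: "clinear (lact a)" "clinear (\<lambda>a. lact a x)"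
    and clinear_ract: "clinear (ract x)" "clinear (\<lambda>x. ract x a)"
    and lact_mult: "lact (a * b) x = lact a (lact b x)"
    and ract_mult: "ract x (a * b) = ract (ract x a) b"
    and lact_ract: "ract (lact a x) b = lact a (ract x b)"

text \<open>
  The elements of \<open>A\<^sup>n\<close> are the lists of length \<open>n\<close> over \<open>A\<close>, and a map on \<open>A\<^sup>n\<close> is a function on
  lists of which only the values at lists of length \<open>n\<close> matter. List indices start at 0, so
  the component \<open>a\<^sub>j\<close> is \<open>a ! (j - 1)\<close>.
\<close>

definition multilinear ::
    "nat \<Rightarrow> ('a::complex_normed_vector list \<Rightarrow> 'x::complex_normed_vector) \<Rightarrow> bool" where
  "multilinear n T \<longleftrightarrow>
     (\<forall>a i. length a = n \<longrightarrow> i < n \<longrightarrow> clinear (\<lambda>b. T (a[i := b])))"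

definition bounded_multilinear ::
    "nat \<Rightarrow> ('a::complex_normed_vector list \<Rightarrow> 'x::complex_normed_vector) \<Rightarrow> bool" where
  "bounded_multilinear n T \<longleftrightarrow> multilinear n T \<and>
     (\<exists>K. \<forall>a. length a = n \<longrightarrow> norm (T a) \<le> K * (\<Prod>i<n. norm (a ! i)))"

definition coboundary ::
    "('a::complex_banach_algebra \<Rightarrow> 'x::complex_banach \<Rightarrow> 'x) \<Rightarrow> ('x \<Rightarrow> 'a \<Rightarrow> 'x) \<Rightarrow> nat \<Rightarrow>
     ('a list \<Rightarrow> 'x) \<Rightarrow> 'a list \<Rightarrow> 'x" where
  "coboundary lact ract n T a =
     lact (a ! 0) (T (drop 1 a))
     + (\<Sum>j=1..n. (- 1) ^ j *\<^sub>R T (take (j - 1) a @ [a ! (j - 1) * a ! j] @ drop (j + 1) a))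
     + (- 1) ^ (n + 1) *\<^sub>R ract (T (take n a)) (a ! n)"

definition cocycle ::
    "('a::complex_banach_algebra \<Rightarrow> 'x::complex_banach \<Rightarrow> 'x) \<Rightarrow> ('x \<Rightarrow> 'a \<Rightarrow> 'x) \<Rightarrow> nat \<Rightarrow>
     ('a list \<Rightarrow> 'x) \<Rightarrow> bool" where
  "cocycle lact ract n T \<longleftrightarrow> multilinear n T \<and>
     (\<forall>a. length a = n + 1 \<longrightarrow> coboundary lact ract n T a = 0)"

definition local_cocycle ::
    "('a::complex_banach_algebra \<Rightarrow> 'x::complex_banach \<Rightarrow> 'x) \<Rightarrow> ('x \<Rightarrow> 'a \<Rightarrow> 'x) \<Rightarrow> nat \<Rightarrow>
     ('a list \<Rightarrow> 'x) \<Rightarrow> bool" where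
  "local_cocycle lact ract n T \<longleftrightarrow> multilinear n T \<and>
     (\<forall>a. length a = n \<longrightarrow> (\<exists>S. cocycle lact ract n S \<and> T a = S a))"

definition bounded_local_cocycle ::
    "('a::complex_banach_algebra \<Rightarrow> 'x::complex_banach \<Rightarrow> 'x) \<Rightarrow> ('x \<Rightarrow> 'a \<Rightarrow> 'x) \<Rightarrow> nat \<Rightarrow>
     ('a list \<Rightarrow> 'x) \<Rightarrow> bool" where
  "bounded_local_cocycle lact ract n T \<longleftrightarrow>
     local_cocycle lact ract n T \<and> bounded_multilinear n T"

end

theory Submission
  imports Defs "HOL-Computational_Algebra.Polynomial"
begin

text \<open>
  Extending maps to the unitization of \<open>A\<close> by \<open>0\<close> on the unit turns cocycles into cocycles, so
  we may assume that \<open>A\<close> and \<open>X\<close> are unital and that \<open>T\<close> vanishes as soon as one argument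
  is \<open>1\<close>. If \<open>a\<^sub>0 a\<^sub>1 = a\<^sub>1 a\<^sub>2 = \<dots> = a\<^sub>n a\<^sub>n\<^sub>+\<^sub>1 = 0\<close>, then in the cocycle equation at
  \<open>(a\<^sub>0, \<dots>, a\<^sub>n)\<close> only the two outer terms survive; multiplying by \<open>a\<^sub>n\<^sub>+\<^sub>1\<close> on the right shows
  that \<open>F(a\<^sub>0, \<dots>, a\<^sub>n\<^sub>+\<^sub>1) = a\<^sub>0 T(a\<^sub>1, \<dots>, a\<^sub>n) a\<^sub>n\<^sub>+\<^sub>1 = 0\<close>, a property that passes from
  cocycles to local cocycles. On a unital C*-algebra a bounded bilinear \<open>\<phi>\<close> such that
  \<open>\<phi> a b = 0\<close> whenever \<open>a b = 0\<close> satisfies \<open>\<phi> c 1 = \<phi> 1 c\<close>. Applying this at each of the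
  \<open>n + 1\<close> junctions of \<open>F\<close> in turn, and using that \<open>T\<close> vanishes on the unit, leaves exactly
  \<open>\<delta>\<^sup>n T = 0\<close>.
\<close>

subsection \<open>Polynomials in a unitary\<close>

text \<open>Locality provides, for each tuple, a cocycle S that is known to agree with
  \<open>T\<close> at that one tuple, whereas the cocycle equation compares n + 2 values of
  \<open>T\<close>. Only consequences of the equation that involve a single value can be
  transferred; a chain of zero products isolates one, since F evaluates \<open>T\<close> just once.
  The witnesses S carry no bound, so all analysis is applied to the F built from \<open>T\<close>,
  never to one built from S.

  The bilinear statement needs partitions of unity in a commutative subalgebra. Those in the real
  part of a unitary suffice: real and imaginary parts recover the unitaries, and differentiating
  one-parameter groups of unitaries recovers the self-adjoint elements. Polynomials in such a real
  part are Laurent polynomials in the unitary, whose norm is controlled by Fourier coefficients on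
  the circle, so no spectrum enters.

  The unit serves as a marker: sliding \<open>c\<close> leaves a 1 behind, and normalisation then
  kills all but one term of the subtracted expression. Hence each slide contributes exactly one
  further term of the coboundary.\<close>

interpretation scaleC: vector_space "scaleC :: complex \<Rightarrow> 'a \<Rightarrow> 'a::complex_normed_vector"
  by (rule vector_space_scaleC)

lemma clinearI:
  assumes "\<And>x y. f (x + y) = f x + f y" "\<And>c x. f (c *\<^sub>C x) = c *\<^sub>C f x"
  shows "clinear f"
  by unfold_locales (simp_all add: assms scaleC_add_right scaleC_add_left)

lemma clinear_add: "clinear f \<Longrightarrow> f (x + y) = f x + f y"
  and clinear_scaleC: "clinear f \<Longrightarrow> f (c *\<^sub>C x) = c *\<^sub>C f x"
  and clinear_zero: "clinear f \<Longrightarrow> f 0 = 0"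
  and clinear_diff: "clinear f \<Longrightarrow> f (x - y) = f x - f y"
  by (simp_all add: linear_iff_module_hom module_hom.add module_hom.scale module_hom.zero module_hom.diff)

lemma clinear_scaleR: "clinear f \<Longrightarrow> f (r *\<^sub>R x) = r *\<^sub>R f x"
  by (metis clinear_scaleC scaleC_of_real)

lemma scaleC_scaleR_commute: "c *\<^sub>C r *\<^sub>R x = r *\<^sub>R c *\<^sub>C (x::'a::complex_normed_vector)"
  by (simp add: scaleC_of_real[symmetric] mult.commute)

lemma bounded_linear_scaleC: "bounded_linear (scaleC c :: 'a \<Rightarrow> 'a::complex_normed_vector)"
  by (rule bounded_linear_intro[where K = "cmod c"])
    (simp_all add: scaleC_add_right scaleC_scaleR_commute norm_scaleC)

section \<open>The involution and powers of normal elements\<close>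

lemma norm_star [simp]: "norm (star x) = norm (x::'a::cstar_algebra)"
proof -
  have le: "norm y \<le> norm (star y)" for y :: 'a
  proof (cases "y = 0")
    case False
    have "norm y * norm y \<le> norm (star y) * norm y"
      using cstar_identity[of y] norm_mult_ineq[of "star y" y] by (simp add: power2_eq_square)
    then show ?thesis using False by simp
  qed simp
  from le[of x] le[of "star x"] show ?thesis by (simp add: star_star)
qed

lemma star_scaleR: "star (r *\<^sub>R x) = r *\<^sub>R star (x::'a::cstar_algebra)"
  using star_scaleC[of "complex_of_real r" x] by (simp add: scaleC_of_real)

lemma bounded_linear_star: "bounded_linear (star :: 'a \<Rightarrow> 'a::cstar_algebra)"
  by (rule bounded_linear_intro[where K = 1]) (simp_all add: star_add star_scaleR)

lemma star_one [simp]: "star 1 = (1::'a::{cstar_algebra,real_normed_algebra_1})"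
  by (metis mult.left_neutral star_mult star_star mult.right_neutral)

lemma star_power: "star (x ^ n) = star (x::'a::{cstar_algebra,real_normed_algebra_1}) ^ n"
  by (induction n) (simp_all add: star_mult power_commutes)

lemma star_exp: "star (exp x) = exp (star (x::'a::{cstar_algebra,real_normed_algebra_1}))"
proof -
  have "(\<lambda>n. star (x ^ n /\<^sub>R fact n)) sums star (exp x)"
    by (rule bounded_linear.sums[OF bounded_linear_star exp_converges])
  then have "(\<lambda>n. star x ^ n /\<^sub>R fact n) sums star (exp x)"
    by (simp add: star_scaleR star_power)
  with exp_converges[of "star x"] show ?thesis by (blast intro: sums_unique2)
qed

text \<open>The C*-identity makes the norm of a normal element multiplicative on powers of two, so that
  an estimate with a subexponential loss on high powers holds without loss.\<close>

lemma normal_norm_square: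
  fixes y :: "'a::{cstar_algebra,real_normed_algebra_1}"
  assumes "star y * y = y * star y"
  shows "norm (y ^ 2) = norm y ^ 2"
proof -
  have "norm (y\<^sup>2) ^ 2 = norm (star (y\<^sup>2) * y\<^sup>2)" by (simp add: cstar_identity)
  also have "star (y\<^sup>2) * y\<^sup>2 = star (star y * y) * (star y * y)"
    by (metis assms mult.assoc power2_eq_square star_mult star_star)
  also have "norm \<dots> = (norm y ^ 2) ^ 2" by (simp add: cstar_identity)
  finally have "norm (y\<^sup>2) ^ 2 = (norm y ^ 2) ^ 2" .
  then show ?thesis by (rule power2_eq_imp_eq) simp_all
qed

lemma normal_norm_power:
  fixes y :: "'a::{cstar_algebra,real_normed_algebra_1}"
  assumes "star y * y = y * star y"
  shows "norm (y ^ 2 ^ k) = norm y ^ 2 ^ k"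
proof (induction k)
  case (Suc k)
  have "star (y ^ 2 ^ k) * y ^ 2 ^ k = y ^ 2 ^ k * star (y ^ 2 ^ k)"
    unfolding star_power by (rule power_commuting_commutes power_commuting_commutes[symmetric]
        | simp add: assms)+
  then have "norm ((y ^ 2 ^ k) ^ 2) = norm (y ^ 2 ^ k) ^ 2" by (rule normal_norm_square)
  with Suc show ?case by (simp add: power_mult[symmetric] mult.commute)
qed simp

lemma le_of_power_le_linear:
  fixes x s :: real
  assumes "0 \<le> x" "0 \<le> s" and le: "\<And>k. x ^ 2 ^ k \<le> (d * 2 ^ k + 1) * s ^ 2 ^ k"
  shows "x \<le> s"
proof (rule ccontr)
  assume "\<not> x \<le> s"
  then have "s < x" by simp
  have "s \<noteq> 0"
  proof
    assume "s = 0"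
    with le[of 0] \<open>s < x\<close> show False by simp
  qed
  with assms have "0 < s" by simp
  define r where "r = x / s"
  have "1 < r" using \<open>s < x\<close> \<open>0 < s\<close> by (simp add: r_def)
  have bound: "r ^ 2 ^ k \<le> d * 2 ^ k + 1" for k
    using le[of k] \<open>0 < s\<close> by (simp add: r_def power_divide divide_le_eq)
  have inv: "norm (inverse r) < 1" using \<open>1 < r\<close> by (simp add: field_simps)
  have "((\<lambda>m. (d * real m + 1) * inverse r ^ m) \<longlongrightarrow> 0) sequentially"
  proof -
    have "(\<lambda>m. of_nat m * inverse r ^ m) \<longlonglongrightarrow> 0"
      by (rule powser_times_n_limit_0[OF inv])
    moreover have "(\<lambda>m. inverse r ^ m) \<longlonglongrightarrow> 0"
      by (rule LIMSEQ_power_zero[OF inv])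
    ultimately have "(\<lambda>m. d * (of_nat m * inverse r ^ m) + inverse r ^ m) \<longlonglongrightarrow> d * 0 + 0"
      by (intro tendsto_add tendsto_mult_left)
    then show ?thesis by (simp add: algebra_simps)
  qed
  then have "eventually (\<lambda>m. (d * real m + 1) * inverse r ^ m < 1) sequentially"
    by (rule order_tendstoD) simp
  then obtain N where N: "\<And>m. m \<ge> N \<Longrightarrow> (d * real m + 1) * inverse r ^ m < 1"
    by (auto simp: eventually_sequentially)
  \<comment> \<open>The limit controls all exponents beyond N, but the hypothesis speaks of powers
    of two only; 2^N is one beyond N.\<close>
  have "(2::nat) ^ N \<ge> N" by (simp add: less_imp_le)
  from N[OF this] have "d * 2 ^ N + 1 < r ^ 2 ^ N"
    using \<open>1 < r\<close> by (simp add: power_inverse field_simps)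
  with bound[of N] show False by simp
qed

text \<open>Horner evaluation with complex coefficients at a point of a noncommutative algebra;
  \<open>poly\<close> keeps coefficients and point in one commutative ring.\<close>

definition peval :: "complex poly \<Rightarrow> 'a \<Rightarrow> 'a::{complex_banach_algebra,real_normed_algebra_1}" where
  "peval p v = fold_coeffs (\<lambda>a y. a *\<^sub>C 1 + v * y) p 0"

lemma peval_0 [simp]: "peval 0 v = 0"
  by (simp add: peval_def)

lemma peval_pCons [simp]: "peval (pCons a p) v = a *\<^sub>C 1 + v * peval p v"
  by (cases "a = 0 \<and> p = 0") (auto simp: peval_def)

lemma peval_add [simp]: "peval (p + q) v = peval p v + peval q v"
  by (induction p q rule: poly_induct2) (simp_all add: algebra_simps scaleC_add_left)

lemma peval_smult [simp]: "peval (smult c p) v = c *\<^sub>C peval p v"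
  by (induction p) (simp_all add: scaleC_add_right scaleC_mult_right)

lemma peval_mult [simp]: "peval (p * q) v = peval p v * peval q v"
  by (induction p) (simp_all add: algebra_simps scaleC_mult_left)

lemma peval_1 [simp]: "peval 1 v = 1"
  by (simp add: one_pCons)

lemma peval_power [simp]: "peval (p ^ n) v = peval p v ^ n"
  by (induction n) simp_all

lemma peval_commute: "w * v = v * w \<Longrightarrow> w * peval p v = peval p v * w"
proof (induction p)
  case (pCons a p)
  have "w * (v * peval p v) = v * (w * peval p v)" by (metis pCons.prems mult.assoc)
  also have "\<dots> = v * peval p v * w" using pCons by (simp add: mult.assoc)
  finally show ?case by (simp add: distrib_left distrib_right scaleC_mult_left scaleC_mult_right)
qed simp

lemma peval_altdef: "peval p v = (\<Sum>k\<le>degree p. coeff p k *\<^sub>C v ^ k)"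
proof (induction p)
  case (pCons a p)
  show ?case
  proof (cases "p = 0")
    case False
    then show ?thesis using pCons.IH
      by (simp add: sum.atMost_Suc_shift sum_distrib_left scaleC_mult_right del: sum.atMost_Suc)
  qed simp
qed simp

text \<open>Discrete Fourier inversion: with w a primitive M-th root of unity and M > deg p, the
  k-th coefficient is the average of p(w^j) w^(-jk) over j < M, hence an average of numbers of
  modulus at most \<open>s\<close>. The exponent M - k replaces -k.\<close>

lemma cmod_coeff_le:
  assumes bound: "\<And>z. cmod z = 1 \<Longrightarrow> cmod (poly p z) \<le> s" and k: "k \<le> degree p"
  shows "cmod (coeff p k) \<le> s"
proof -
  define M where "M = degree p + 1"
  have M: "M > 0" "k < M" using k by (auto simp: M_def)
  define w where "w = cis (2 * pi / M)"
  have w1: "cmod w = 1" by (simp add: w_def)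
  have wM: "w ^ M = 1"
  proof -
    have "real M * (2 * pi / real M) = 2 * pi" using M by simp
    then show ?thesis by (simp only: w_def Complex.DeMoivre cis_2pi)
  qed
  have w_ne: "w ^ l \<noteq> 1" if "0 < l" "l < M" for l
  proof
    assume "w ^ l = 1"
    then have "cis (2 * pi * l / M) = 1" by (simp add: w_def Complex.DeMoivre mult_ac)
    then have "cos (2 * pi * l / M) = 1" by (metis cis.simps(1) one_complex.simps(1))
    then obtain i :: int where "2 * pi * l / M = of_int i * (2 * pi)"
      by (auto simp: cos_one_2pi_int mult_ac)
    then have "real l = of_int i * M" using M by (simp add: field_simps)
    then have "int l = i * int M" by (metis of_int_eq_iff of_int_mult of_int_of_nat_eq)
    with that show False
      by (metis dvd_triv_right int_dvd_int_iff nat_dvd_not_less)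
  qed
  have geo: "(\<Sum>j<M. (w ^ l) ^ j) = (if M dvd l then of_nat M else 0)" for l
  proof (cases "M dvd l")
    case True
    then obtain q where "l = M * q" by auto
    then have "w ^ l = 1" by (simp add: power_mult wM)
    then show ?thesis using True by simp
  next
    case False
    have "w ^ l = w ^ (l mod M)"
    proof -
      have "w ^ l = w ^ (M * (l div M) + l mod M)" by simp
      also have "\<dots> = w ^ (l mod M)" unfolding power_add power_mult wM by simp
      finally show ?thesis .
    qed
    with w_ne[of "l mod M"] False M have ne: "w ^ l \<noteq> 1" by (simp add: dvd_eq_mod_eq_0)
    have "(w ^ l) ^ M = 1" by (metis power_mult mult.commute wM power_one)
    then show ?thesis using ne False by (simp add: geometric_sum)
  qed
  have pow: "(w ^ (i + l)) ^ j = (w ^ j) ^ i * (w ^ j) ^ l" for i j l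
    by (simp add: power_add power_mult_distrib power_mult[symmetric] mult.commute)
  have "(\<Sum>j<M. poly p (w ^ j) * (w ^ j) ^ (M - k))
      = (\<Sum>j<M. \<Sum>i\<le>degree p. coeff p i * (w ^ (i + (M - k))) ^ j)"
    by (simp only: poly_altdef sum_distrib_right pow mult.assoc)
  also have "\<dots> = (\<Sum>i\<le>degree p. coeff p i * (\<Sum>j<M. (w ^ (i + (M - k))) ^ j))"
    by (subst sum.swap) (simp add: sum_distrib_left)
  also have "\<dots> = (\<Sum>i\<le>degree p. if i = k then coeff p i * of_nat M else 0)"
  proof (rule sum.cong[OF refl])
    fix i assume "i \<in> {..degree p}"
    then have "i < M" by (simp add: M_def)
    \<comment> \<open>As i and k are below M, the number i + (M - k) lies strictly between 0 and 2M,
      where M is the only multiple of M.\<close>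
    have "M dvd i + (M - k) \<longleftrightarrow> i = k"
    proof
      assume "M dvd i + (M - k)"
      then obtain q where q: "i + (M - k) = M * q" by auto
      have "q = 1"
      proof -
        have "q \<noteq> 0" using q M by (intro notI) simp
        moreover have "M * q < M * 2" using q \<open>i < M\<close> by linarith
        ultimately show ?thesis by simp
      qed
      with q M show "i = k" by simp
    qed (use M in simp)
    then show "coeff p i * (\<Sum>j<M. (w ^ (i + (M - k))) ^ j)
        = (if i = k then coeff p i * of_nat M else 0)"
      by (simp only: geo) simp
  qed
  also have "\<dots> = coeff p k * of_nat M" using k by simp
  finally have eq: "coeff p k * of_nat M = (\<Sum>j<M. poly p (w ^ j) * (w ^ j) ^ (M - k))" ..
  have "cmod (coeff p k) * M = cmod (coeff p k * of_nat M)" by (simp add: norm_mult)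
  also have "\<dots> \<le> (\<Sum>j<M. s)"
    unfolding eq by (rule sum_norm_le) (simp add: norm_mult norm_power w1 bound)
  finally have "cmod (coeff p k) * M \<le> s * M" by (simp add: mult.commute)
  then show ?thesis using M by simp
qed

definition unitary :: "'a::{cstar_algebra,real_normed_algebra_1} \<Rightarrow> bool" where
  "unitary v \<longleftrightarrow> star v * v = 1 \<and> v * star v = 1"

lemma unitary_star: "unitary v \<Longrightarrow> unitary (star v)"
  by (simp add: unitary_def star_star)

lemma norm_unitary_power: "unitary v \<Longrightarrow> norm (v ^ k) \<le> 1"
proof -
  assume "unitary v"
  then have "norm v ^ 2 = 1" using cstar_identity[of v] by (simp add: unitary_def)
  then have "norm v = 1" by (simp add: power2_eq_1_iff) (smt (verit) norm_ge_zero)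
  then show "norm (v ^ k) \<le> 1" using norm_power_ineq[of v k] by simp
qed

text \<open>Von Neumann's inequality for a unitary. Summing coefficient bounds loses the factor deg
  p + 1. For p^(2^k) the loss is only linear in 2^k while the norm of the normal element p(v) is
  raised to the power 2^k, so the loss disappears as k grows.\<close>

lemma norm_peval_le:
  assumes v: "unitary v" and bound: "\<And>z. cmod z = 1 \<Longrightarrow> cmod (poly p z) \<le> s"
  shows "norm (peval p v) \<le> s"
proof -
  have "s \<ge> 0" using order_trans[OF norm_ge_zero bound[of 1]] by simp
  have crude: "norm (peval q v) \<le> (real (degree q) + 1) * t"
    if "\<And>z. cmod z = 1 \<Longrightarrow> cmod (poly q z) \<le> t" for q t
  proof -
    have "norm (peval q v) \<le> (\<Sum>k\<le>degree q. t)"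
      unfolding peval_altdef
    proof (rule sum_norm_le)
      fix k assume "k \<in> {..degree q}"
      then have "cmod (coeff q k) \<le> t" using cmod_coeff_le[of q t k] that by simp
      then have "cmod (coeff q k) * norm (v ^ k) \<le> t * 1"
        using norm_unitary_power[OF v, of k] order_trans[OF norm_ge_zero, of "coeff q k" t]
        by (intro mult_mono) auto
      then show "norm (coeff q k *\<^sub>C v ^ k) \<le> t" by (simp add: norm_scaleC)
    qed
    then show ?thesis by (simp add: algebra_simps)
  qed
  have comm: "star v * v = v * star v" using v by (simp add: unitary_def)
  \<comment> \<open>Normality: \<open>star v\<close> commutes with v, hence with p(v); by adjoints v
    commutes with \<open>star (peval p v)\<close>, hence so does p(v).\<close>
  have "star v * peval p v = peval p v * star v" by (rule peval_commute) (rule comm)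
  then have "star (peval p v) * v = v * star (peval p v)" by (metis star_mult star_star)
  then have normal: "star (peval p v) * peval p v = peval p v * star (peval p v)"
    by (rule peval_commute)
  show ?thesis
  proof (rule le_of_power_le_linear)
    fix k :: nat
    have "norm (peval p v) ^ 2 ^ k = norm (peval (p ^ 2 ^ k) v)"
      by (simp add: normal_norm_power[OF normal])
    also have "\<dots> \<le> (real (degree (p ^ 2 ^ k)) + 1) * s ^ 2 ^ k"
      by (rule crude) (simp add: norm_power bound power_mono)
    also have "\<dots> \<le> (real (degree p) * 2 ^ k + 1) * s ^ 2 ^ k"
    proof (rule mult_right_mono)
      have "real (degree (p ^ 2 ^ k)) \<le> real (degree p * 2 ^ k)"
        using degree_power_le[of p "2 ^ k"] by (simp only: of_nat_le_iff)
      then show "real (degree (p ^ 2 ^ k)) + 1 \<le> real (degree p) * 2 ^ k + 1" by simp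
    qed (use \<open>s \<ge> 0\<close> in simp)
    finally show "norm (peval p v) ^ 2 ^ k \<le> (real (degree p) * 2 ^ k + 1) * s ^ 2 ^ k" .
  qed (use \<open>s \<ge> 0\<close> in auto)
qed

subsection \<open>Continuous functional calculus for the real part of a unitary\<close>

definition half_sum :: "'a::{cstar_algebra,real_normed_algebra_1} \<Rightarrow> 'a" where
  "half_sum v = (1/2) *\<^sub>R (v + star v)"

text \<open>\<^term>\<open>polyrel v g y\<close> encodes \<open>y = g((v + v\<^sup>*)/2)\<close> for polynomial \<open>g\<close>: multiplying by a power of
  \<open>v\<close> clears the negative powers of the Laurent polynomial \<open>g((v + v\<^sup>-\<^sup>1)/2)\<close>.\<close>

definition polyrel :: "'a::{cstar_algebra,real_normed_algebra_1} \<Rightarrow> (real \<Rightarrow> real) \<Rightarrow> 'a \<Rightarrow> bool" where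
  "polyrel v g y \<longleftrightarrow> y * v = v * y \<and> (\<exists>d P. y * v ^ d = peval P v \<and>
     (\<forall>z. cmod z = 1 \<longrightarrow> poly P z = z ^ d * g (Re z)))"

lemma polyrel_const: "polyrel v (\<lambda>x. c) (c *\<^sub>R 1)"
  unfolding polyrel_def
  by (intro conjI exI[of _ "0::nat"] exI[of _ "[:complex_of_real c:]"]) (simp_all add: scaleC_of_real)

lemma peval_monom_Suc: "peval (monom a d) v = a *\<^sub>C v ^ d"
  by (induction d) (simp_all add: monom_Suc monom_0 scaleC_mult_right)

lemma polyrel_half_sum:
  assumes "unitary v"
  shows "polyrel v (\<lambda>x. x) (half_sum v)"
  unfolding polyrel_def
\<comment> \<open>On the unit circle the conjugate of z is its inverse, so z Re z = (1 +
  z^2)/2.\<close>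
proof (intro conjI exI[of _ "1::nat"] exI[of _ "[:1/2, 0, 1/2:]"] allI impI)
  show "half_sum v * v = v * half_sum v"
    using assms by (simp add: half_sum_def unitary_def algebra_simps)
  have "(1/2) *\<^sub>C y = (1/2) *\<^sub>R y" for y :: 'a
    using scaleC_of_real[of "1/2" y] by simp
  then show "half_sum v * v ^ 1 = peval [:1/2, 0, 1/2:] v"
    using assms by (simp add: half_sum_def unitary_def algebra_simps)
  fix z :: complex assume "cmod z = 1"
  then have "z * cnj z = 1" by (simp add: complex_norm_square[symmetric])
  moreover have "complex_of_real (Re z) = (z + cnj z) / 2" by (simp add: complex_add_cnj)
  ultimately show "poly [:1/2, 0, 1/2:] z = z ^ 1 * complex_of_real (Re z)"
    by (simp add: field_simps)
qed

lemma polyrel_mult: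
  assumes "polyrel v g y" "polyrel v g' y'"
  shows "polyrel v (\<lambda>x. g x * g' x) (y * y')"
proof -
  from assms(1) obtain d P where 1: "y * v = v * y" "y * v ^ d = peval P v"
    "\<And>z. cmod z = 1 \<Longrightarrow> poly P z = z ^ d * g (Re z)" by (auto simp: polyrel_def)
  from assms(2) obtain d' P' where 2: "y' * v = v * y'" "y' * v ^ d' = peval P' v"
    "\<And>z. cmod z = 1 \<Longrightarrow> poly P' z = z ^ d' * g' (Re z)" by (auto simp: polyrel_def)
  have "y' * v ^ d = v ^ d * y'" by (rule power_commuting_commutes[symmetric]) (simp add: 2)
  then have "y * y' * v ^ (d + d') = (y * v ^ d) * (y' * v ^ d')"
    by (metis mult.assoc power_add)
  then have "y * y' * v ^ (d + d') = peval (P * P') v" by (simp add: 1 2)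
  moreover have "y * y' * v = v * (y * y')" by (metis 1(1) 2(1) mult.assoc)
  ultimately show ?thesis unfolding polyrel_def
    by (intro conjI exI[of _ "d + d'"] exI[of _ "P * P'"]) (simp_all add: 1 2 power_add)
qed

lemma polyrel_add:
  assumes "polyrel v g y" "polyrel v g' y'"
  shows "polyrel v (\<lambda>x. g x + g' x) (y + y')"
proof -
  from assms(1) obtain d P where 1: "y * v = v * y" "y * v ^ d = peval P v"
    "\<And>z. cmod z = 1 \<Longrightarrow> poly P z = z ^ d * g (Re z)" by (auto simp: polyrel_def)
  from assms(2) obtain d' P' where 2: "y' * v = v * y'" "y' * v ^ d' = peval P' v"
    "\<And>z. cmod z = 1 \<Longrightarrow> poly P' z = z ^ d' * g' (Re z)" by (auto simp: polyrel_def)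
  \<comment> \<open>Common denominator: each summand is multiplied by the power of v belonging to
    the other.\<close>
  have "(y + y') * v ^ (d + d') = v ^ d' * (y * v ^ d) + v ^ d * (y' * v ^ d')"
  proof -
    have "v ^ d' * y = y * v ^ d'" "v ^ d * y' = y' * v ^ d"
      by (metis power_commuting_commutes 1(1), metis power_commuting_commutes 2(1))
    then have "v ^ d' * (y * v ^ d) = y * v ^ (d' + d)" "v ^ d * (y' * v ^ d') = y' * v ^ (d + d')"
      by (metis mult.assoc power_add)+
    then show ?thesis by (simp add: distrib_right add.commute)
  qed
  then have "(y + y') * v ^ (d + d') = peval (monom 1 d' * P + monom 1 d * P') v"
    by (simp add: 1 2 peval_monom_Suc)
  moreover have "(y + y') * v = v * (y + y')" by (simp add: 1 2 distrib_left distrib_right)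
  ultimately show ?thesis unfolding polyrel_def
    by (intro conjI exI[of _ "d + d'"] exI[of _ "monom 1 d' * P + monom 1 d * P'"])
      (simp_all add: 1 2 power_add poly_monom algebra_simps)
qed

text \<open>The factor z^d has modulus 1 on the circle, and multiplication by
  \<open>star v ^ d\<close>, of norm at most 1, recovers y from P(v). So a bound for g on [-1, 1],
  the range of Re on the circle, bounds y.\<close>

lemma polyrel_norm:
  assumes v: "unitary v" and "polyrel v g y" and bound: "\<And>x. x \<in> {-1..1} \<Longrightarrow> \<bar>g x\<bar> \<le> s"
  shows "norm y \<le> s"
proof -
  from assms(2) obtain d P where P: "y * v ^ d = peval P v"
    "\<And>z. cmod z = 1 \<Longrightarrow> poly P z = z ^ d * g (Re z)" by (auto simp: polyrel_def)
  have "norm (peval P v) \<le> s"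
  proof (rule norm_peval_le[OF v])
    fix z assume "cmod z = 1"
    then have "Re z \<in> {-1..1}" using abs_Re_le_cmod[of z] by auto
    from bound[OF this] \<open>cmod z = 1\<close> show "cmod (poly P z) \<le> s"
      by (simp add: P norm_mult norm_power)
  qed
  moreover have "y = peval P v * star v ^ d"
  proof -
    have "v ^ d * star v ^ d = 1"
      using v by (simp add: unitary_def left_right_inverse_power)
    then show ?thesis by (metis P(1) mult.assoc mult.right_neutral)
  qed
  moreover have "norm (star v ^ d) \<le> 1" by (intro norm_unitary_power unitary_star v)
  ultimately show ?thesis
    by (smt (verit) norm_mult_ineq mult_left_le norm_ge_zero)
qed

lemma polyrel_exists:
  assumes v: "unitary v" and "real_polynomial_function g"
  shows "\<exists>y. polyrel v g y"
  using assms(2)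
proof (induction rule: real_polynomial_function.induct)
  case (linear f)
  then obtain c where "f = (\<lambda>x. x * c)" by (metis real_bounded_linear)
  then show ?case using polyrel_mult[OF polyrel_half_sum[OF v] polyrel_const[of v c]] by blast
next
  case (const c)
  show ?case using polyrel_const by blast
next
  case (add f g)
  then show ?case using polyrel_add by blast
next
  case (mult f g)
  then show ?case using polyrel_mult by blast
qed

text \<open>Likewise \<^term>\<open>funrel v f y\<close> encodes \<open>y = f((v + v\<^sup>*)/2)\<close> for continuous \<open>f\<close> on \<open>[-1, 1]\<close>.\<close>

definition funrel :: "'a::{cstar_algebra,real_normed_algebra_1} \<Rightarrow> (real \<Rightarrow> real) \<Rightarrow> 'a \<Rightarrow> bool" where
  "funrel v f y \<longleftrightarrow> (\<exists>g Y. (\<forall>n. polyrel v (g n) (Y n)) \<and>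
     uniform_limit {-1..1} g f sequentially \<and> Y \<longlonglongrightarrow> y)"

lemma funrel_polyrel: "polyrel v f y \<Longrightarrow> funrel v f y"
  unfolding funrel_def by (intro exI[of _ "\<lambda>_. f"] exI[of _ "\<lambda>_. y"]) (auto intro: uniform_limit_const)

lemma funrel_add:
  assumes "funrel v f y" "funrel v f' y'"
  shows "funrel v (\<lambda>x. f x + f' x) (y + y')"
proof -
  from assms obtain g Y g' Y' where
    "\<forall>n. polyrel v (g n) (Y n)" "uniform_limit {-1..1} g f sequentially" "Y \<longlonglongrightarrow> y"
    "\<forall>n. polyrel v (g' n) (Y' n)" "uniform_limit {-1..1} g' f' sequentially" "Y' \<longlonglongrightarrow> y'"
    unfolding funrel_def by blast
  then show ?thesis unfolding funrel_def
    by (intro exI[of _ "\<lambda>n x. g n x + g' n x"] exI[of _ "\<lambda>n. Y n + Y' n"])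
      (auto intro: polyrel_add uniform_limit_add tendsto_add)
qed

lemma funrel_mult:
  assumes "funrel v f y" "funrel v f' y'" "bounded (f ` {-1..1})" "bounded (f' ` {-1..1})"
  shows "funrel v (\<lambda>x. f x * f' x) (y * y')"
proof -
  from assms(1,2) obtain g Y g' Y' where
    "\<forall>n. polyrel v (g n) (Y n)" "uniform_limit {-1..1} g f sequentially" "Y \<longlonglongrightarrow> y"
    "\<forall>n. polyrel v (g' n) (Y' n)" "uniform_limit {-1..1} g' f' sequentially" "Y' \<longlonglongrightarrow> y'"
    unfolding funrel_def by blast
  then show ?thesis unfolding funrel_def using assms(3,4)
    by (intro exI[of _ "\<lambda>n x. g n x * g' n x"] exI[of _ "\<lambda>n. Y n * Y' n"])
      (auto intro: polyrel_mult uniform_lim_mult tendsto_mult)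
qed

lemma funrel_scaleR: "funrel v f y \<Longrightarrow> funrel v (\<lambda>x. c * f x) (c *\<^sub>R y)"
proof -
  assume "funrel v f y"
  then obtain g Y where gY: "\<forall>n. polyrel v (g n) (Y n)" "uniform_limit {-1..1} g f sequentially"
    "Y \<longlonglongrightarrow> y" unfolding funrel_def by blast
  have "polyrel v (\<lambda>x. c * g n x) (c *\<^sub>R Y n)" for n
    using polyrel_mult[OF polyrel_const[of v c] gY(1)[rule_format, of n]] by simp
  moreover have "uniform_limit {-1..1} (\<lambda>n x. c * g n x) (\<lambda>x. c * f x) sequentially"
    by (rule bounded_linear.uniform_limit[OF bounded_linear_mult_right gY(2)])
  ultimately show ?thesis unfolding funrel_def
    by (intro exI[of _ "\<lambda>n x. c * g n x"] exI[of _ "\<lambda>n. c *\<^sub>R Y n"])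
      (auto intro: tendsto_intros gY(3))
qed

lemma funrel_sum:
  assumes "finite I" "\<And>i. i \<in> I \<Longrightarrow> funrel v (f i) (y i)"
  shows "funrel v (\<lambda>x. \<Sum>i\<in>I. f i x) (\<Sum>i\<in>I. y i)"
  using assms
proof (induction I)
  case empty
  show ?case using funrel_polyrel[OF polyrel_const[of v 0]] by simp
qed (auto intro: funrel_add)

lemma funrel_norm:
  assumes v: "unitary v" and "funrel v f y" and bound: "\<And>x. x \<in> {-1..1} \<Longrightarrow> \<bar>f x\<bar> \<le> s"
  shows "norm y \<le> s"
proof -
  from assms(2) obtain g Y where gY: "\<And>n. polyrel v (g n) (Y n)"
    "uniform_limit {-1..1} g f sequentially" "Y \<longlonglongrightarrow> y" unfolding funrel_def by blast
  show ?thesis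
  proof (rule field_le_epsilon)
    fix e :: real assume "0 < e"
    with gY(2) have "\<forall>\<^sub>F n in sequentially. \<forall>x\<in>{-1..1}. dist (g n x) (f x) < e"
      by (simp add: uniform_limit_iff)
    then have "\<forall>\<^sub>F n in sequentially. norm (Y n) \<le> s + e"
    proof eventually_elim
      case (elim n)
      show ?case
      proof (rule polyrel_norm[OF v gY(1)])
        fix x :: real assume "x \<in> {-1..1}"
        with elim bound show "\<bar>g n x\<bar> \<le> s + e" by (fastforce simp: dist_real_def)
      qed
    qed
    moreover have "(\<lambda>n. norm (Y n)) \<longlonglongrightarrow> norm y" by (rule tendsto_norm[OF gY(3)])
    ultimately show "norm y \<le> s + e" by (intro tendsto_upperbound) auto
  qed
qed

text \<open>The norm bound with s = 0, applied to the difference. Identities among elements of the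
  calculus can thus be read off from the functions.\<close>

lemma funrel_unique:
  assumes "unitary v" "funrel v f y" "funrel v f' y'" "\<And>x. x \<in> {-1..1} \<Longrightarrow> f x = f' x"
  shows "y = y'"
proof -
  have "funrel v (\<lambda>x. f x + (- 1) * f' x) (y + (- 1) *\<^sub>R y')"
    by (intro funrel_add funrel_scaleR assms)
  from funrel_norm[OF assms(1) this, of 0] assms(4) show ?thesis by simp
qed

text \<open>\<open>polyrel_norm\<close> turns uniform distance on [-1, 1] into norm distance, so the
  values of Weierstrass approximants form a Cauchy sequence.\<close>

lemma funrel_exists:
  assumes v: "unitary v" and f: "continuous_on {-1..1} f"
  shows "\<exists>y. funrel v f y"
proof -
  have "\<exists>g. real_polynomial_function g \<and> (\<forall>x\<in>{-1..1}. \<bar>f x - g x\<bar> < inverse (real (Suc n)))" for n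
  proof -
    have "0 < inverse (real (Suc n))" by simp
    from Stone_Weierstrass_real_polynomial_function[OF compact_Icc f this] show ?thesis by metis
  qed
  then obtain g where g: "\<And>n. real_polynomial_function (g n)"
    "\<And>n x. x \<in> {-1..1} \<Longrightarrow> \<bar>f x - g n x\<bar> < inverse (real (Suc n))" by metis
  obtain Y where Y: "\<And>n. polyrel v (g n) (Y n)" using polyrel_exists[OF v g(1)] by metis
  have lim: "uniform_limit {-1..1} g f sequentially"
    unfolding uniform_limit_iff
  proof (intro allI impI)
    fix e :: real assume "0 < e"
    then obtain N where N: "inverse (real (Suc N)) < e" using reals_Archimedean by blast
    show "\<forall>\<^sub>F n in sequentially. \<forall>x\<in>{-1..1}. dist (g n x) (f x) < e"
      unfolding eventually_sequentially
    proof (intro exI[of _ N] allI impI ballI)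
      fix n x assume "N \<le> n" "x \<in> {-1..1::real}"
      then have "inverse (real (Suc n)) \<le> inverse (real (Suc N))" by (intro le_imp_inverse_le) auto
      with g(2)[OF \<open>x \<in> _\<close>, of n] N show "dist (g n x) (f x) < e"
        unfolding dist_real_def by linarith
    qed
  qed
  have diff: "norm (Y m - Y n) \<le> s" if "\<And>x. x \<in> {-1..1} \<Longrightarrow> \<bar>g m x - g n x\<bar> \<le> s" for m n s
  proof -
    have "polyrel v (\<lambda>x. g m x + (- 1) * g n x) (Y m + ((- 1) *\<^sub>R 1) * Y n)"
      by (intro polyrel_add polyrel_mult polyrel_const Y)
    from polyrel_norm[OF v this, of s] that show ?thesis by simp
  qed
  have "Cauchy Y"
  proof (rule metric_CauchyI)
    fix e :: real assume "0 < e"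
    then have "0 < e/4" by simp
    then have "\<forall>\<^sub>F n in sequentially. \<forall>x\<in>{-1..1}. dist (g n x) (f x) < e/4"
      by (rule uniform_limitD[OF lim])
    then obtain N where N: "\<And>n x. n \<ge> N \<Longrightarrow> x \<in> {-1..1} \<Longrightarrow> dist (g n x) (f x) < e/4"
      unfolding eventually_sequentially by blast
    show "\<exists>M. \<forall>m\<ge>M. \<forall>n\<ge>M. dist (Y m) (Y n) < e"
    proof (intro exI[of _ N] allI impI)
      fix m n assume "N \<le> m" "N \<le> n"
      have "norm (Y m - Y n) \<le> e/2"
      proof (rule diff)
        fix x :: real assume "x \<in> {-1..1}"
        with N[OF \<open>N \<le> m\<close> this] N[OF \<open>N \<le> n\<close> this] show "\<bar>g m x - g n x\<bar> \<le> e/2"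
          unfolding dist_real_def by linarith
      qed
      with \<open>0 < e\<close> show "dist (Y m) (Y n) < e" by (simp add: dist_norm)
    qed
  qed
  then obtain y where "Y \<longlonglongrightarrow> y" by (auto simp: Cauchy_convergent_iff convergent_def)
  with Y lim show ?thesis unfolding funrel_def by blast
qed

subsection \<open>Bilinear maps vanishing on zero products\<close>

text \<open>Averaging over the signs \<open>\<epsilon>\<close> kills the off-diagonal terms of
  \<open>\<phi> (\<Sum>i. \<epsilon>\<^sub>i a\<^sub>i) (\<Sum>i. \<epsilon>\<^sub>i b\<^sub>i)\<close>.\<close>

lemma norm_sum_bilinear_le:
  assumes "bounded_bilinear \<phi>" "finite I"
    and "\<And>\<epsilon>::'i \<Rightarrow> real. (\<And>i. \<epsilon> i = 1 \<or> \<epsilon> i = - 1) \<Longrightarrow>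
      norm (r + \<phi> (\<Sum>i\<in>I. \<epsilon> i *\<^sub>R a i) (\<Sum>i\<in>I. \<epsilon> i *\<^sub>R b i)) \<le> C"
  shows "norm (r + (\<Sum>i\<in>I. \<phi> (a i) (b i))) \<le> C"
  using assms(2,3)
proof (induction I arbitrary: r)
  case empty
  from empty[of "\<lambda>_. 1"] show ?case using bounded_bilinear.zero_left[OF assms(1)] by simp
next
  case (insert j I)
  note bil = bounded_bilinear.add_left[OF assms(1)] bounded_bilinear.add_right[OF assms(1)]
    bounded_bilinear.diff_left[OF assms(1)] bounded_bilinear.diff_right[OF assms(1)]
  \<comment> \<open>The free remainder \<open>r\<close> makes the induction work: it absorbs the
    diagonal term of j before the signs on I are averaged.\<close>
  have "norm ((r + \<phi> (a j) (b j)) + (\<Sum>i\<in>I. \<phi> (a i) (b i))) \<le> C"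
  proof (rule insert.IH)
    fix \<epsilon> :: "'i \<Rightarrow> real" assume \<epsilon>: "\<And>i. \<epsilon> i = 1 \<or> \<epsilon> i = - 1"
    let ?X = "\<Sum>i\<in>I. \<epsilon> i *\<^sub>R a i" and ?Y = "\<Sum>i\<in>I. \<epsilon> i *\<^sub>R b i"
    have upd: "(\<Sum>i\<in>insert j I. (\<epsilon>(j := s)) i *\<^sub>R c i) = s *\<^sub>R c j + (\<Sum>i\<in>I. \<epsilon> i *\<^sub>R c i)"
      for s and c :: "'i \<Rightarrow> 'z::real_vector"
      using insert.hyps by (auto intro!: sum.cong)
    have plus: "norm (r + \<phi> (a j + ?X) (b j + ?Y)) \<le> C"
      using insert.prems[of "\<epsilon>(j := 1)"] \<epsilon> unfolding upd by auto
    have minus: "norm (r + \<phi> (?X - a j) (?Y - b j)) \<le> C"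
      using insert.prems[of "\<epsilon>(j := - 1)"] \<epsilon> unfolding upd by auto
    \<comment> \<open>Adding the two choices of sign for j cancels the mixed terms of j with the
      signed sums over I.\<close>
    have "2 *\<^sub>R (r + \<phi> (a j) (b j) + \<phi> ?X ?Y)
        = (r + \<phi> (a j + ?X) (b j + ?Y)) + (r + \<phi> (?X - a j) (?Y - b j))"
      by (simp add: bil algebra_simps scaleR_2)
    then have "norm (2 *\<^sub>R (r + \<phi> (a j) (b j) + \<phi> ?X ?Y)) \<le> C + C"
      using norm_triangle_mono[OF plus minus] by simp
    then show "norm (r + \<phi> (a j) (b j) + \<phi> ?X ?Y) \<le> C" by simp
  qed
  then show ?case using insert.hyps by (simp add: add.assoc)
qed

text \<open>Signs do not affect the pointwise bound on the sum of the |f_i|, so every signed sum has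
  norm at most C, and likewise D. The resulting bound does not grow with the number of
  terms.\<close>

lemma funrel_sum_bilinear_le:
  fixes \<phi> :: "'a::{cstar_algebra,real_normed_algebra_1} \<Rightarrow> 'a \<Rightarrow> 'x::real_normed_vector" and I :: "'i set"
  assumes \<phi>: "bounded_bilinear \<phi>" "\<And>a b. norm (\<phi> a b) \<le> norm a * norm b * M" "0 \<le> M"
    and v: "unitary v" and "finite I"
    and f: "\<And>i. i \<in> I \<Longrightarrow> funrel v (f i) (a i)" and g: "\<And>i. i \<in> I \<Longrightarrow> funrel v (g i) (b i)"
    and C: "\<And>x. x \<in> {-1..1} \<Longrightarrow> (\<Sum>i\<in>I. \<bar>f i x\<bar>) \<le> C"
    and D: "\<And>x. x \<in> {-1..1} \<Longrightarrow> (\<Sum>i\<in>I. \<bar>g i x\<bar>) \<le> D"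
  shows "norm (\<Sum>i\<in>I. \<phi> (a i) (b i)) \<le> C * D * M"
proof -
  have sign: "norm (\<Sum>i\<in>I. \<epsilon> i *\<^sub>R c i) \<le> B"
    if "\<And>i. \<epsilon> i = 1 \<or> \<epsilon> i = - 1" "\<And>i. i \<in> I \<Longrightarrow> funrel v (h i) (c i)"
      "\<And>x. x \<in> {-1..1} \<Longrightarrow> (\<Sum>i\<in>I. \<bar>h i x\<bar>) \<le> B" for \<epsilon> :: "'i \<Rightarrow> real" and c h B
  proof (rule funrel_norm[OF v])
    show "funrel v (\<lambda>x. \<Sum>i\<in>I. \<epsilon> i * h i x) (\<Sum>i\<in>I. \<epsilon> i *\<^sub>R c i)"
      by (intro funrel_sum funrel_scaleR that \<open>finite I\<close>)
    fix x :: real assume x: "x \<in> {-1..1}"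
    have "\<bar>\<Sum>i\<in>I. \<epsilon> i * h i x\<bar> \<le> (\<Sum>i\<in>I. \<bar>\<epsilon> i * h i x\<bar>)" by (rule sum_abs)
    also have "\<dots> = (\<Sum>i\<in>I. \<bar>h i x\<bar>)"
    proof (rule sum.cong[OF refl])
      fix i show "\<bar>\<epsilon> i * h i x\<bar> = \<bar>h i x\<bar>" using that(1)[of i] by auto
    qed
    finally show "\<bar>\<Sum>i\<in>I. \<epsilon> i * h i x\<bar> \<le> B" using that(3)[OF x] by simp
  qed
  have "norm (0 + (\<Sum>i\<in>I. \<phi> (a i) (b i))) \<le> C * D * M"
  proof (rule norm_sum_bilinear_le[OF \<phi>(1) \<open>finite I\<close>])
    fix \<epsilon> :: "'i \<Rightarrow> real" assume \<epsilon>: "\<And>i. \<epsilon> i = 1 \<or> \<epsilon> i = - 1"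
    let ?a = "\<Sum>i\<in>I. \<epsilon> i *\<^sub>R a i" and ?b = "\<Sum>i\<in>I. \<epsilon> i *\<^sub>R b i"
    have a: "norm ?a \<le> C" and b: "norm ?b \<le> D"
      by (rule sign[OF \<epsilon> f C] sign[OF \<epsilon> g D]; assumption)+
    have "norm (\<phi> ?a ?b) \<le> norm ?a * norm ?b * M" by (rule \<phi>)
    also have "\<dots> \<le> C * D * M"
      using a b \<phi>(3) order_trans[OF norm_ge_zero a] by (intro mult_right_mono mult_mono) auto
    finally show "norm (0 + \<phi> ?a ?b) \<le> C * D * M" by simp
  qed
  then show ?thesis by simp
qed

section \<open>Partition of unity by tent functions\<close>

definition clip :: "real \<Rightarrow> real" where
  "clip x = max 0 (min 1 x)"

text \<open>In the variable y = N x + N, which runs through [0, 2N], this is the tent of height 1 on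
  [i - 1, i + 1] with peak at y = i, that is at x = \<open>node N i\<close>. Writing it as a
  difference of clips makes sums over i telescope.\<close>

definition bump :: "nat \<Rightarrow> nat \<Rightarrow> real \<Rightarrow> real" where
  "bump N i x = clip (N * x + N + 1 - i) - clip (N * x + N - i)"

definition node :: "nat \<Rightarrow> nat \<Rightarrow> real" where
  "node N i = (real i - N) / N"

lemma bump_nonneg: "0 \<le> bump N i x"
  by (simp add: bump_def clip_def)

lemma bump_nonzero:
  assumes "bump N i x \<noteq> 0"
  shows "\<bar>N * x + N - i\<bar> < 1"
  using assms unfolding bump_def clip_def by (simp split: if_splits add: max_def min_def)

lemma bump_sum:
  assumes "x \<in> {-1..1}"
  shows "(\<Sum>i<Suc (2 * N). bump N i x) = 1"
proof -
  \<comment> \<open>For n = 2N + 1 and x in [-1, 1] the first clip is saturated at 1 and the second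
    at 0.\<close>
  have "(\<Sum>i<n. bump N i x) = clip (N * x + N + 1) - clip (N * x + N + 1 - n)" for n
    by (induction n) (simp_all add: bump_def algebra_simps)
  moreover have "real N * x \<le> N" "- real N \<le> real N * x"
    using mult_left_mono[of x 1 N] mult_left_mono[of "-1" x N] assms by auto
  ultimately show ?thesis by (simp add: clip_def)
qed

lemma bump_mult_far:
  assumes "i + 2 \<le> j \<or> j + 2 \<le> i"
  shows "bump N i x * bump N j x = 0"
proof (rule ccontr)
  assume "bump N i x * bump N j x \<noteq> 0"
  with bump_nonzero[of N i x] bump_nonzero[of N j x]
  have "\<bar>N * x + N - i\<bar> < 1" "\<bar>N * x + N - j\<bar> < 1" by auto
  with assms show False by linarith
qed

lemma continuous_on_bump [continuous_intros]: "continuous_on S (bump N i)"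
  unfolding bump_def[abs_def] clip_def by (intro continuous_intros)

text \<open>One step of width 1/N leads from x to the peak of bump j, at most one more to the peak
  of its neighbour i.\<close>

lemma bump_node:
  assumes "0 < N" "i \<le> j + 1" "j \<le> i + 1" "bump N j x \<noteq> 0"
  shows "\<bar>x - node N i\<bar> \<le> 2 / N"
proof -
  have "N * (x - node N i) = N * x + N - i" using assms(1) by (simp add: node_def field_simps)
  then have "real N * \<bar>x - node N i\<bar> = \<bar>N * x + N - i\<bar>"
    by (metis abs_mult abs_of_nat)
  also have "\<dots> \<le> 2" using bump_nonzero[OF assms(4)] assms(2,3) by linarith
  finally show ?thesis using assms(1) by (simp add: field_simps)
qed

definition adjacent :: "nat \<Rightarrow> (nat \<times> nat) set" where
  "adjacent n = {(i, j). i < n \<and> j < n \<and> i \<le> j + 1 \<and> j \<le> i + 1}"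

lemma finite_adjacent: "finite (adjacent n)"
  by (rule finite_subset[of _ "{..<n} \<times> {..<n}"]) (auto simp: adjacent_def)

text \<open>Each index has at most three neighbours, itself included; the second estimate follows
  from the symmetry of \<open>adjacent\<close>.\<close>

lemma sum_adjacent_le:
  fixes w :: "nat \<Rightarrow> real"
  assumes "\<And>i. 0 \<le> w i"
  shows "(\<Sum>(i,j)\<in>adjacent n. w i) \<le> 3 * (\<Sum>i<n. w i)"
    and "(\<Sum>(i,j)\<in>adjacent n. w j) \<le> 3 * (\<Sum>i<n. w i)"
proof -
  have card: "card {j. j < n \<and> i \<le> j + 1 \<and> j \<le> i + 1} \<le> 3" for i
  proof -
    have "{j. j < n \<and> i \<le> j + 1 \<and> j \<le> i + 1} \<subseteq> {i - 1, i, i + 1}" by auto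
    then have "card {j. j < n \<and> i \<le> j + 1 \<and> j \<le> i + 1} \<le> card {i - 1, i, i + 1}"
      by (intro card_mono) auto
    also have "\<dots> \<le> 3" by (simp add: card_insert_if)
    finally show ?thesis .
  qed
  have "adjacent n = (SIGMA i:{..<n}. {j. j < n \<and> i \<le> j + 1 \<and> j \<le> i + 1})"
    by (auto simp: adjacent_def)
  then have "(\<Sum>(i,j)\<in>adjacent n. w i) = (\<Sum>i<n. \<Sum>j | j < n \<and> i \<le> j + 1 \<and> j \<le> i + 1. w i)"
    by (subst sum.Sigma) auto
  also have "\<dots> = (\<Sum>i<n. real (card {j. j < n \<and> i \<le> j + 1 \<and> j \<le> i + 1}) * w i)"
    by (simp only: sum_constant)
  also have "\<dots> \<le> (\<Sum>i<n. 3 * w i)"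
    by (rule sum_mono, rule mult_right_mono) (use card assms in auto)
  finally show 1: "(\<Sum>(i,j)\<in>adjacent n. w i) \<le> 3 * (\<Sum>i<n. w i)" by (simp add: sum_distrib_left)
  have "(\<Sum>(i,j)\<in>adjacent n. w j) = (\<Sum>(i,j)\<in>adjacent n. w i)"
    by (rule sum.reindex_bij_witness[of _ prod.swap prod.swap]) (auto simp: adjacent_def)
  with 1 show "(\<Sum>(i,j)\<in>adjacent n. w j) \<le> 3 * (\<Sum>i<n. w i)" by simp
qed

text \<open>With \<open>h\<close> the half sum and a partition of unity \<open>e\<^sub>i\<close> of mesh \<open>1/N\<close>, the difference
  \<open>\<phi> h 1 - \<phi> 1 h\<close> is a sum of \<open>\<phi> ((h - x\<^sub>i) e\<^sub>i) e\<^sub>j - \<phi> e\<^sub>i ((h - x\<^sub>i) e\<^sub>j)\<close> over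
  adjacent \<open>i\<close>, \<open>j\<close>. Bounding these \<open>O(N)\<close> terms of size \<open>O(1/N)\<close> one by one is not enough;
  sign averaging bounds their sum by \<open>O(1/N)\<close>.\<close>

lemma zero_product_half_sum:
  fixes \<phi> :: "'a::{cstar_algebra,real_normed_algebra_1} \<Rightarrow> 'a \<Rightarrow> 'x::real_normed_vector"
  assumes \<phi>: "bounded_bilinear \<phi>" and zero: "\<And>a b. a * b = 0 \<Longrightarrow> \<phi> a b = 0" and v: "unitary v"
  shows "\<phi> (half_sum v) 1 = \<phi> 1 (half_sum v)"
proof -
  interpret bounded_bilinear \<phi> by (rule \<phi>)
  obtain M where M: "0 \<le> M" "\<And>a b. norm (\<phi> a b) \<le> norm a * norm b * M"
    using nonneg_bounded by blast
  let ?h = "half_sum v"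
  have rel1: "funrel v (\<lambda>_. 1) 1"
    using funrel_polyrel[OF polyrel_const[of v 1]] by simp
  have relh: "funrel v (\<lambda>x. x) ?h" by (rule funrel_polyrel[OF polyrel_half_sum[OF v]])
  \<comment> \<open>36 = 2 * (2 * 3 * 3): two sums, each with the factor 2/N from
    \<open>bump_node\<close> and a factor 3 per argument from
    \<open>sum_adjacent_le\<close>.\<close>
  have bound: "norm (\<phi> ?h 1 - \<phi> 1 ?h) \<le> 36 * M * inverse N" if "0 < N" for N :: nat
  proof -
    define n where "n = Suc (2 * N)"
    have "\<exists>y. funrel v (bump N i) y" for i
      by (intro funrel_exists v continuous_intros)
    then obtain e where e: "\<And>i. funrel v (bump N i) (e i)" by metis
    have bdd: "bounded (f ` {-1..1})" if "continuous_on {-1..1} f" for f :: "real \<Rightarrow> real"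
      by (intro compact_imp_bounded compact_continuous_image that compact_Icc)
    define c where "c i = (?h - node N i *\<^sub>R 1)" for i
    have relc: "funrel v (\<lambda>x. x + (- node N i) * 1) (c i)" for i
      using funrel_add[OF relh funrel_scaleR[OF rel1, of "- node N i"]] by (simp add: c_def)
    have relce: "funrel v (\<lambda>x. (x + (- node N i) * 1) * bump N j x) (c i * e j)" for i j
      by (intro funrel_mult relc e bdd continuous_intros)
    have one: "(\<Sum>i<n. e i) = 1"
      by (rule funrel_unique[OF v funrel_sum[OF _ e] rel1]) (simp_all add: n_def bump_sum del: sum.lessThan_Suc)
    have far: "e i * e j = 0" if "i + 2 \<le> j \<or> j + 2 \<le> i" for i j
    proof (rule funrel_unique[OF v])
      show "funrel v (\<lambda>x. bump N i x * bump N j x) (e i * e j)"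
        by (intro funrel_mult e bdd continuous_intros)
      show "funrel v (\<lambda>x. 0) 0" using funrel_scaleR[OF rel1, of 0] by simp
    qed (use that in \<open>simp_all add: bump_mult_far\<close>)
    have comm: "c i * e j = e j * c i" for i j
      by (rule funrel_unique[OF v relce funrel_mult[OF e relc bdd bdd]])
        (auto intro!: continuous_intros simp: mult.commute)
    \<comment> \<open>Every unit, including the implicit one in h = h 1, is expanded as the sum of
      the e_i.\<close>
    have "\<phi> ?h 1 - \<phi> 1 ?h = (\<Sum>i<n. \<Sum>j<n. \<phi> (?h * e i) (e j) - \<phi> (e i) (?h * e j))"
    proof -
      have "\<phi> ?h 1 = \<phi> (\<Sum>i<n. ?h * e i) (\<Sum>j<n. e j)" "\<phi> 1 ?h = \<phi> (\<Sum>i<n. e i) (\<Sum>j<n. ?h * e j)"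
        by (simp_all add: one sum_distrib_left[symmetric])
      then show ?thesis
        by (simp only: sum_left) (simp only: sum_right sum_subtractf)
    qed
    \<comment> \<open>Replacing h by h - x_i in both terms changes nothing, as the scalar x_i can be
      moved from one argument to the other.\<close>
    also have "\<dots> = (\<Sum>i<n. \<Sum>j<n. \<phi> (c i * e i) (e j) - \<phi> (e i) (c i * e j))"
      by (simp add: c_def left_diff_distrib diff_left diff_right scaleR_left scaleR_right)
    also have "\<dots> = (\<Sum>(i,j)\<in>{..<n} \<times> {..<n}. \<phi> (c i * e i) (e j) - \<phi> (e i) (c i * e j))"
      by (simp add: sum.cartesian_product)
    \<comment> \<open>For distant i and j the product e_i e_j is 0, and c_i commutes with the e's,
      so both argument pairs have product 0.\<close>
    also have "\<dots> = (\<Sum>(i,j)\<in>adjacent n. \<phi> (c i * e i) (e j) - \<phi> (e i) (c i * e j))"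
    proof (rule sum.mono_neutral_right)
      show "\<forall>p\<in>{..<n} \<times> {..<n} - adjacent n.
          (case p of (i, j) \<Rightarrow> \<phi> (c i * e i) (e j) - \<phi> (e i) (c i * e j)) = 0"
      proof (rule ballI, unfold split_paired_all)
        fix i j :: nat assume "(i, j) \<in> {..<n} \<times> {..<n} - adjacent n"
        then have "i + 2 \<le> j \<or> j + 2 \<le> i" by (auto simp: adjacent_def)
        then have "e i * e j = 0" by (rule far)
        then have "c i * e i * e j = 0" "e i * (c i * e j) = 0"
          by (metis mult.assoc mult_zero_right, metis comm mult.assoc mult_zero_left)
        then show "(case (i, j) of (i, j) \<Rightarrow> \<phi> (c i * e i) (e j) - \<phi> (e i) (c i * e j)) = 0"
          by (simp add: zero)
      qed
    qed (auto simp: adjacent_def)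
    also have "\<dots> = (\<Sum>p\<in>adjacent n. \<phi> (c (fst p) * e (fst p)) (e (snd p)))
        - (\<Sum>p\<in>adjacent n. \<phi> (e (fst p)) (c (fst p) * e (snd p)))"
      by (simp add: sum_subtractf case_prod_unfold)
    finally have eq: "\<phi> ?h 1 - \<phi> 1 ?h = \<dots>" .
    have sum_fst: "(\<Sum>p\<in>adjacent n. \<bar>bump N (fst p) x\<bar>) \<le> 3"
      and sum_snd: "(\<Sum>p\<in>adjacent n. \<bar>bump N (snd p) x\<bar>) \<le> 3" if "x \<in> {-1..1}" for x
      using sum_adjacent_le[of "\<lambda>i. bump N i x" n] bump_sum[OF that, of N]
      by (simp_all add: n_def bump_nonneg case_prod_unfold del: sum.lessThan_Suc)
    have near: "\<bar>(x + (- node N i) * 1) * bump N j x\<bar> \<le> 2 / N * \<bar>bump N j x\<bar>"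
      if "i \<le> j + 1" "j \<le> i + 1" for i j x
    proof (cases "bump N j x = 0")
      case False
      from mult_right_mono[OF bump_node[OF \<open>0 < N\<close> that this] abs_ge_zero[of "bump N j x"]]
      show ?thesis by (simp add: abs_mult)
    qed simp
    have "norm (\<Sum>p\<in>adjacent n. \<phi> (c (fst p) * e (fst p)) (e (snd p))) \<le> (2 / N * 3) * 3 * M"
    proof (rule funrel_sum_bilinear_le[OF \<phi> M(2) M(1) v finite_adjacent])
      fix x :: real assume x: "x \<in> {-1..1}"
      have "(\<Sum>p\<in>adjacent n. \<bar>(x + (- node N (fst p)) * 1) * bump N (fst p) x\<bar>)
          \<le> (\<Sum>p\<in>adjacent n. 2 / N * \<bar>bump N (fst p) x\<bar>)"
        by (intro sum_mono near) auto
      also have "\<dots> \<le> 2 / N * 3"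
        unfolding sum_distrib_left[symmetric] by (intro mult_left_mono sum_fst x) simp
      finally show "(\<Sum>p\<in>adjacent n. \<bar>(x + (- node N (fst p)) * 1) * bump N (fst p) x\<bar>) \<le> 2 / N * 3" .
    qed (rule relce e sum_snd, assumption?)+
    moreover have "norm (\<Sum>p\<in>adjacent n. \<phi> (e (fst p)) (c (fst p) * e (snd p))) \<le> 3 * (2 / N * 3) * M"
    proof (rule funrel_sum_bilinear_le[OF \<phi> M(2) M(1) v finite_adjacent])
      fix x :: real assume x: "x \<in> {-1..1}"
      have "(\<Sum>p\<in>adjacent n. \<bar>(x + (- node N (fst p)) * 1) * bump N (snd p) x\<bar>)
          \<le> (\<Sum>p\<in>adjacent n. 2 / N * \<bar>bump N (snd p) x\<bar>)"
        by (intro sum_mono near) (auto simp: adjacent_def)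
      also have "\<dots> \<le> 2 / N * 3"
        unfolding sum_distrib_left[symmetric] by (intro mult_left_mono sum_snd x) simp
      finally show "(\<Sum>p\<in>adjacent n. \<bar>(x + (- node N (fst p)) * 1) * bump N (snd p) x\<bar>) \<le> 2 / N * 3" .
    qed (rule e relce sum_fst, assumption?)+
    ultimately have "norm (\<phi> ?h 1 - \<phi> 1 ?h) \<le> (2 / N * 3) * 3 * M + 3 * (2 / N * 3) * M"
      unfolding eq by (intro order_trans[OF norm_triangle_ineq4] add_mono)
    then show ?thesis by (simp add: field_simps)
  qed
  have "(\<lambda>N. 36 * M * inverse (real (Suc N))) \<longlonglongrightarrow> 36 * M * 0"
    by (intro tendsto_mult_left LIMSEQ_inverse_real_of_nat)
  then have "norm (\<phi> ?h 1 - \<phi> 1 ?h) \<le> 36 * M * 0"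
    by (rule tendsto_lowerbound) (use bound[of "Suc _"] in auto)
  then show ?thesis by simp
qed

text \<open>The elements \<open>c\<close> with \<open>\<phi> c 1 = \<phi> 1 c\<close> form a closed subspace. It contains every unitary,
  hence \<open>exp (\<i>th)\<close> for self-adjoint \<open>h\<close>, hence the derivative \<open>\<i>h\<close> at \<open>t = 0\<close>.\<close>

lemma zero_product_commute:
  fixes \<phi> :: "'a::{cstar_algebra,real_normed_algebra_1} \<Rightarrow> 'a \<Rightarrow> 'x::complex_normed_vector"
  assumes \<phi>: "bounded_bilinear \<phi>" and zero: "\<And>a b. a * b = 0 \<Longrightarrow> \<phi> a b = 0"
    and clin: "\<And>a. clinear (\<phi> a)" "\<And>b. clinear (\<lambda>a. \<phi> a b)"
  shows "\<phi> c 1 = \<phi> 1 c"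
proof -
  interpret bounded_bilinear \<phi> by (rule \<phi>)
  define L where "L c = \<phi> c 1 - \<phi> 1 c" for c
  have bl: "bounded_linear L"
    unfolding L_def by (intro bounded_linear_sub bounded_linear_left bounded_linear_right)
  have Ladd: "L (a + b) = L a + L b" for a b by (simp add: L_def add_left add_right)
  have LC: "L (k *\<^sub>C a) = k *\<^sub>C L a" for k a
    using clinear_scaleC[OF clin(1)[of 1], of k a] clinear_scaleC[OF clin(2)[of 1], of k a]
    by (simp add: L_def scaleC.scale_right_diff_distrib)
  have neg: "(- 1) *\<^sub>C x = - x" for x :: 'a by simp
  have Lunitary: "L u = 0" if u: "unitary u" for u
  proof -
    \<comment> \<open>The half sum of -i u is the imaginary part of u, so the previous lemma at u
      and at -i u handles both parts.\<close>
    have "unitary ((- \<i>) *\<^sub>C u)"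
      using u by (simp add: unitary_def star_scaleC scaleC_mult_left scaleC_mult_right scaleC_scaleC
          del: scaleC.scale_minus_left)
    with u have "L (half_sum u) = 0" "L (half_sum ((- \<i>) *\<^sub>C u)) = 0"
      using zero_product_half_sum[OF \<phi> zero] by (simp_all add: L_def)
    moreover have "u = half_sum u + \<i> *\<^sub>C half_sum ((- \<i>) *\<^sub>C u)"
    proof -
      have "\<i> *\<^sub>C half_sum ((- \<i>) *\<^sub>C u) = (1/2) *\<^sub>R (u - star u)"
        by (simp add: half_sum_def star_scaleC scaleC_scaleR_commute scaleC_add_right scaleC_scaleC neg
            del: scaleC.scale_minus_left)
      then show ?thesis by (simp add: half_sum_def algebra_simps scaleR_add_left[symmetric])
    qed
    ultimately show ?thesis by (metis Ladd LC add_0 scaleC.scale_zero_right)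
  qed
  have Lself: "L h = 0" if h: "star h = h" for h
  proof -
    let ?y = "\<i> *\<^sub>C h"
    have "L (exp (t *\<^sub>R ?y)) = 0" for t :: real
    proof (rule Lunitary)
      have "star (t *\<^sub>R ?y) = - (t *\<^sub>R ?y)" by (simp add: star_scaleR star_scaleC h)
      then show "unitary (exp (t *\<^sub>R ?y))"
        by (simp add: unitary_def star_exp exp_minus_inverse) (metis exp_minus_inverse minus_minus)
    qed
    moreover have "((\<lambda>t. L (exp (t *\<^sub>R ?y))) has_vector_derivative L (exp (0 *\<^sub>R ?y) * ?y)) (at 0)"
      by (intro bounded_linear.has_vector_derivative[OF bl] exp_scaleR_has_vector_derivative_right)
    ultimately have "L ?y = 0"
      using vector_derivative_unique_at[OF _ has_vector_derivative_const[of 0]] by simp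
    then have "(- \<i>) *\<^sub>C L ?y = 0" by simp
    then show ?thesis by (simp add: LC scaleC_scaleC del: scaleC.scale_minus_left)
  qed
  have "star (half_sum x) = half_sum x" for x :: 'a
    by (simp add: half_sum_def star_scaleR star_add star_star add.commute)
  moreover have "c = half_sum c + \<i> *\<^sub>C half_sum ((- \<i>) *\<^sub>C c)"
  proof -
    have "\<i> *\<^sub>C half_sum ((- \<i>) *\<^sub>C c) = (1/2) *\<^sub>R (c - star c)"
      by (simp add: half_sum_def star_scaleC scaleC_scaleR_commute scaleC_add_right scaleC_scaleC neg
          del: scaleC.scale_minus_left)
    then show ?thesis by (simp add: half_sum_def algebra_simps scaleR_add_left[symmetric])
  qed
  ultimately have "L c = 0" by (metis Lself Ladd LC add_0 scaleC.scale_zero_right)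
  then show ?thesis by (simp add: L_def)
qed

subsection \<open>The unitization of a C*-algebra\<close>

datatype 'a unitization = Unitization (base: 'a) (scal: complex)

lemma unitization_eq_iff: "x = y \<longleftrightarrow> base x = base y \<and> scal x = scal y"
  by (cases x; cases y) simp

instantiation unitization :: (complex_banach_algebra) real_algebra_1
begin

definition "0 = Unitization 0 0"
definition "1 = Unitization 0 1"
definition "x + y = Unitization (base x + base y) (scal x + scal y)"
definition "x - y = Unitization (base x - base y) (scal x - scal y)"
definition "- x = Unitization (- base x) (- scal x)"
definition "r *\<^sub>R x = Unitization (r *\<^sub>R base x) (r *\<^sub>R scal x)"
definition "x * y = Unitization (base x * base y + scal x *\<^sub>C base y + scal y *\<^sub>C base x) (scal x * scal y)"

instance
  by standard
    (simp_all add: zero_unitization_def one_unitization_def plus_unitization_def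
      minus_unitization_def uminus_unitization_def scaleR_unitization_def times_unitization_def
      algebra_simps scaleC_add_right scaleC_add_left scaleC_mult_left scaleC_mult_right
      scaleC_scaleR_commute scaleC_of_real[symmetric] scaleR_conv_of_real unitization_eq_iff)

end

lemma base_simps [simp]:
  "base 0 = 0" "base 1 = 0" "base (x + y) = base x + base y" "base (x - y) = base x - base y"
  "base (- x) = - base x" "base (r *\<^sub>R x) = r *\<^sub>R base x"
  "base (x * y) = base x * base y + scal x *\<^sub>C base y + scal y *\<^sub>C base x"
  and scal_simps [simp]:
  "scal 0 = 0" "scal 1 = 1" "scal (x + y) = scal x + scal y" "scal (x - y) = scal x - scal y"
  "scal (- x) = - scal x" "scal (r *\<^sub>R x) = r *\<^sub>R scal x" "scal (x * y) = scal x * scal y"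
  by (simp_all add: zero_unitization_def one_unitization_def plus_unitization_def
      minus_unitization_def uminus_unitization_def scaleR_unitization_def times_unitization_def)

section \<open>The operator norm on the unitization\<close>

definition mulop :: "'a unitization \<Rightarrow> 'a \<Rightarrow> 'a::complex_banach_algebra" where
  "mulop x b = base x * b + scal x *\<^sub>C b"

lemma bounded_linear_mulop: "bounded_linear (mulop x)"
  unfolding mulop_def[abs_def]
  by (intro bounded_linear_add bounded_linear_mult_right bounded_linear_scaleC)

lemma mulop_simps: "mulop 1 b = b" "mulop (x + y) b = mulop x b + mulop y b"
  "mulop (r *\<^sub>R x) b = r *\<^sub>R mulop x b" "mulop (x * y) b = mulop x (mulop y b)"
  by (simp_all add: mulop_def algebra_simps scaleC_add_right scaleC_add_left scaleC_mult_left
      scaleC_mult_right scaleC_scaleR_commute scaleC_of_real[symmetric] scaleR_conv_of_real[where 'a = complex] mult.commute)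

text \<open>\<open>mulop x\<close> is left multiplication by x on the ideal A. Testing it on the
  adjoint of a = \<open>base x\<close> produces a \<open>star a\<close>, of norm |a|^2, up to a
  scalar multiple of \<open>star a\<close>; then divide by |a|. This makes the norm below definite
  and \<open>base\<close> continuous.\<close>

lemma norm_le_mulop: "norm (base x) \<le> onorm (mulop x) + cmod (scal x)"
  for x :: "'a::cstar_algebra unitization"
proof (cases "base x = 0")
  case True
  then show ?thesis using onorm_pos_le[OF bounded_linear_mulop, of x] by simp
next
  case False
  let ?a = "base x"
  have "norm ?a ^ 2 = norm (?a * star ?a)"
    using cstar_identity[of "star ?a"] by (simp add: star_star)
  also have "?a * star ?a = mulop x (star ?a) - scal x *\<^sub>C star ?a" by (simp add: mulop_def)
  also have "norm \<dots> \<le> norm (mulop x (star ?a)) + norm (scal x *\<^sub>C star ?a)"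
    by (rule norm_triangle_ineq4)
  also have "\<dots> \<le> onorm (mulop x) * norm ?a + cmod (scal x) * norm ?a"
    using onorm[OF bounded_linear_mulop, of x "star ?a"] by (simp add: norm_scaleC)
  finally have "norm ?a * norm ?a \<le> (onorm (mulop x) + cmod (scal x)) * norm ?a"
    by (simp add: power2_eq_square algebra_simps)
  with False show ?thesis by simp
qed

text \<open>If \<open>A\<close> has no unit, the operator norm of \<open>mulop\<close> already is the C*-norm of the unitization.
  If it has one, the unitization is \<open>A \<oplus> \<complex>\<close> and \<open>mulop\<close> forgets the second summand,
  which the maximum restores.\<close>

instantiation unitization :: (cstar_algebra) real_normed_algebra_1
begin

definition "norm x = max (onorm (mulop x)) (cmod (scal x))"
definition "sgn (x :: 'a unitization) = x /\<^sub>R norm x"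
definition "dist (x :: 'a unitization) y = norm (x - y)"
definition "(uniformity :: ('a unitization \<times> 'a unitization) filter)
  = (INF e\<in>{0<..}. principal {(x, y). dist x y < e})"
definition "open (S :: 'a unitization set)
  \<longleftrightarrow> (\<forall>x\<in>S. \<forall>\<^sub>F (x', y) in uniformity. x' = x \<longrightarrow> y \<in> S)"

instance
proof
  fix x y :: "'a unitization" and r :: real and S :: "'a unitization set"
  show "dist x y = norm (x - y)" by (rule dist_unitization_def)
  show "sgn x = x /\<^sub>R norm x" by (rule sgn_unitization_def)
  show "(uniformity :: ('a unitization \<times> 'a unitization) filter)
      = (INF e\<in>{0<..}. principal {(x, y). dist x y < e})"
    by (rule uniformity_unitization_def)
  show "open S \<longleftrightarrow> (\<forall>x\<in>S. \<forall>\<^sub>F (x', y) in uniformity. x' = x \<longrightarrow> y \<in> S)"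
    by (rule open_unitization_def)
  have pos: "0 \<le> onorm (mulop z)" for z :: "'a unitization"
    by (rule onorm_pos_le[OF bounded_linear_mulop])
  show "norm x = 0 \<longleftrightarrow> x = 0"
  proof
    assume "norm x = 0"
    then have "scal x = 0" "onorm (mulop x) = 0"
      using pos[of x] norm_ge_zero[of "scal x"] unfolding norm_unitization_def
      by (auto simp: max_def simp del: norm_ge_zero split: if_splits)
    with norm_le_mulop[of x] show "x = 0" by (simp add: unitization_eq_iff)
  next
    assume "x = 0"
    then have "mulop x = (\<lambda>_. 0)" by (simp add: mulop_def fun_eq_iff)
    with \<open>x = 0\<close> show "norm x = 0" by (simp add: norm_unitization_def onorm_zero)
  qed
  have "mulop (x + y) = (\<lambda>b. mulop x b + mulop y b)" by (simp add: mulop_simps fun_eq_iff)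
  then have "onorm (mulop (x + y)) \<le> onorm (mulop x) + onorm (mulop y)"
    by (simp add: onorm_triangle bounded_linear_mulop)
  then show "norm (x + y) \<le> norm x + norm y"
    using norm_triangle_ineq[of "scal x" "scal y"] unfolding norm_unitization_def scal_simps
    by linarith
  have "mulop (r *\<^sub>R x) = (\<lambda>b. r *\<^sub>R mulop x b)" by (simp add: mulop_simps fun_eq_iff)
  then have "onorm (mulop (r *\<^sub>R x)) = \<bar>r\<bar> * onorm (mulop x)"
    by (simp add: onorm_scaleR bounded_linear_mulop)
  then show "norm (r *\<^sub>R x) = \<bar>r\<bar> * norm x"
    by (simp add: norm_unitization_def max_mult_distrib_left)
  have "mulop (x * y) = mulop x \<circ> mulop y" by (simp add: mulop_simps fun_eq_iff)
  then have "onorm (mulop (x * y)) \<le> onorm (mulop x) * onorm (mulop y)"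
    by (simp add: onorm_compose bounded_linear_mulop)
  also have "\<dots> \<le> norm x * norm y"
    by (intro mult_mono) (simp_all add: norm_unitization_def pos le_max_iff_disj)
  moreover have "cmod (scal (x * y)) \<le> norm x * norm y"
    unfolding scal_simps norm_mult
    by (intro mult_mono) (simp_all add: norm_unitization_def pos le_max_iff_disj)
  ultimately show "norm (x * y) \<le> norm x * norm y"
    by (simp add: norm_unitization_def[of "x * y"])
  have "onorm (mulop (1 :: 'a unitization)) \<le> 1"
    by (rule onorm_bound) (simp_all add: mulop_simps)
  then show "norm (1 :: 'a unitization) = 1" by (simp add: norm_unitization_def)
qed

end

lemma norm_scal_le: "cmod (scal x) \<le> norm x"
  and norm_mulop_le: "onorm (mulop x) \<le> norm x"
  for x :: "'a::cstar_algebra unitization"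
  by (simp_all add: norm_unitization_def)

lemma norm_base_le: "norm (base x) \<le> 2 * norm x" for x :: "'a::cstar_algebra unitization"
  using norm_le_mulop[of x] norm_mulop_le[of x] norm_scal_le[of x] by linarith

lemma norm_unitization_le: "norm x \<le> norm (base x) + cmod (scal x)"
  for x :: "'a::cstar_algebra unitization"
proof -
  have "onorm (mulop x) \<le> norm (base x) + cmod (scal x)"
  proof (rule onorm_bound)
    fix b :: 'a
    have "norm (mulop x b) \<le> norm (base x * b) + norm (scal x *\<^sub>C b)"
      unfolding mulop_def by (rule norm_triangle_ineq)
    also have "\<dots> \<le> norm (base x) * norm b + cmod (scal x) * norm b"
      by (intro add_mono norm_mult_ineq) (simp add: norm_scaleC)
    finally show "norm (mulop x b) \<le> (norm (base x) + cmod (scal x)) * norm b"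
      by (simp add: algebra_simps)
  qed simp
  then show ?thesis by (simp add: norm_unitization_def)
qed

lemma bounded_linear_base: "bounded_linear (base :: 'a unitization \<Rightarrow> 'a::cstar_algebra)"
  by (rule bounded_linear_intro[where K = 2]) (simp_all add: mult.commute[of _ 2] norm_base_le)

lemma bounded_linear_scal: "bounded_linear (scal :: 'a::cstar_algebra unitization \<Rightarrow> complex)"
  by (rule bounded_linear_intro[where K = 1]) (simp_all add: norm_scal_le)

text \<open>The norm is equivalent to the sum of the norms of the two components, so completeness is
  inherited from them.\<close>

instance unitization :: (cstar_algebra) banach
proof
  fix X :: "nat \<Rightarrow> 'a unitization" assume X: "Cauchy X"
  have "Cauchy (\<lambda>n. base (X n))" "Cauchy (\<lambda>n. scal (X n))"
    by (intro bounded_linear.Cauchy[OF bounded_linear_base X]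
        bounded_linear.Cauchy[OF bounded_linear_scal X])+
  then obtain a l where "(\<lambda>n. base (X n)) \<longlonglongrightarrow> a" "(\<lambda>n. scal (X n)) \<longlonglongrightarrow> l"
    by (auto simp: Cauchy_convergent_iff convergent_def)
  then have "(\<lambda>n. norm (base (X n) - a) + cmod (scal (X n) - l)) \<longlonglongrightarrow> 0"
    by (auto intro!: tendsto_eq_intros)
  then have "(\<lambda>n. norm (X n - Unitization a l)) \<longlonglongrightarrow> 0"
    by (rule tendsto_0_le[where K = 1])
      (use norm_unitization_le[of "X _ - Unitization a l"] in \<open>auto intro!: always_eventually\<close>)
  then show "convergent X"
    unfolding convergent_def by (metis LIM_zero_cancel tendsto_norm_zero_iff)
qed

instantiation unitization :: (cstar_algebra) cstar_algebra
begin

definition "c *\<^sub>C x = Unitization (c *\<^sub>C base x) (c * scal x)"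
definition "star x = Unitization (star (base x)) (cnj (scal x))"

instance
proof
  fix x y :: "'a unitization" and c d :: complex and r :: real
  show "c *\<^sub>C (x + y) = c *\<^sub>C x + c *\<^sub>C y" "(c + d) *\<^sub>C x = c *\<^sub>C x + d *\<^sub>C x"
    "c *\<^sub>C d *\<^sub>C x = (c * d) *\<^sub>C x" "complex_of_real r *\<^sub>C x = r *\<^sub>R x"
    "(c *\<^sub>C x) * y = c *\<^sub>C (x * y)" "x * (c *\<^sub>C y) = c *\<^sub>C (x * y)"
    by (simp_all add: scaleC_unitization_def unitization_eq_iff scaleC_add_right scaleC_add_left
        scaleC_scaleC scaleC_of_real scaleC_mult_left scaleC_mult_right algebra_simps
        scaleR_conv_of_real[where 'a = complex])
  show "star (x + y) = star x + star y" "star (c *\<^sub>C x) = cnj c *\<^sub>C star x"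
    "star (x * y) = star y * star x" "star (star x) = x"
    by (simp_all add: scaleC_unitization_def star_unitization_def unitization_eq_iff star_add
        star_scaleC star_mult star_star algebra_simps)
  have le: "norm (c *\<^sub>C x) \<le> cmod c * norm x" for c and x :: "'a unitization"
  proof -
    have "onorm (mulop (c *\<^sub>C x)) \<le> cmod c * onorm (mulop x)"
    proof (rule onorm_bound)
      fix b
      have "mulop (c *\<^sub>C x) b = c *\<^sub>C mulop x b"
        by (simp add: mulop_def scaleC_unitization_def scaleC_add_right scaleC_mult_left)
      then show "norm (mulop (c *\<^sub>C x) b) \<le> cmod c * onorm (mulop x) * norm b"
        using onorm[OF bounded_linear_mulop, of x b]
        by (simp add: norm_scaleC mult.assoc mult_left_mono)
    qed (simp add: onorm_pos_le bounded_linear_mulop)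
    also have "\<dots> \<le> cmod c * norm x" by (intro mult_left_mono norm_mulop_le) simp
    finally have "onorm (mulop (c *\<^sub>C x)) \<le> cmod c * norm x" .
    moreover have "cmod (scal (c *\<^sub>C x)) \<le> cmod c * norm x"
      using norm_scal_le[of x] by (simp add: scaleC_unitization_def norm_mult mult_left_mono)
    ultimately show ?thesis unfolding norm_unitization_def[of "c *\<^sub>C x"] by (rule max.boundedI)
  qed
  show "norm (c *\<^sub>C x) = cmod c * norm x"
  proof (cases "c = 0")
    case True
    then show ?thesis using le[of c x] by simp
  next
    case False
    have "inverse c *\<^sub>C c *\<^sub>C x = x"
      using False by (simp add: scaleC_unitization_def unitization_eq_iff)
    then have "norm x \<le> inverse (cmod c) * norm (c *\<^sub>C x)"
      using le[of "inverse c" "c *\<^sub>C x"] by (simp add: norm_inverse)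
    then have "cmod c * norm x \<le> norm (c *\<^sub>C x)"
      using False by (simp add: field_simps)
    with le[of c x] show ?thesis by simp
  qed
  \<comment> \<open>For b in A, |x b|^2 is the norm of \<open>star b\<close> times
    (\<open>star x\<close> x b), at most |b| times the norm of the second factor.\<close>
  have op: "onorm (mulop x) ^ 2 \<le> onorm (mulop (star x * x))" for x :: "'a unitization"
  proof -
    let ?M = "onorm (mulop (star x * x))"
    have M: "0 \<le> ?M" by (rule onorm_pos_le[OF bounded_linear_mulop])
    have "onorm (mulop x) \<le> sqrt ?M"
    proof (rule onorm_bound)
      fix b
      have "norm (mulop x b) ^ 2 = norm (star (mulop x b) * mulop x b)" by (simp add: cstar_identity)
      also have "star (mulop x b) * mulop x b = star b * mulop (star x * x) b"
        by (simp add: mulop_simps)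
          (simp add: mulop_def star_unitization_def star_add star_mult star_scaleC algebra_simps
            scaleC_mult_left scaleC_mult_right)
      also have "norm \<dots> \<le> norm (star b) * norm (mulop (star x * x) b)" by (rule norm_mult_ineq)
      also have "\<dots> \<le> norm b * (?M * norm b)"
        using onorm[OF bounded_linear_mulop, of "star x * x" b] by (simp add: mult_left_mono)
      also have "\<dots> = (sqrt ?M * norm b) ^ 2"
        using M by (simp add: power_mult_distrib power2_eq_square)
      finally show "norm (mulop x b) \<le> sqrt ?M * norm b"
        by (rule power2_le_imp_le) (simp add: M)
    qed (simp add: M)
    then show ?thesis using M by (metis onorm_pos_le[OF bounded_linear_mulop] power_mono real_sqrt_pow2)
  qed
  \<comment> \<open>Combine \<open>op\<close> with submultiplicativity and cancel one factor
    \<open>onorm (mulop x)\<close>; if it is 0 the claim is trivial.\<close>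
  have op_star: "onorm (mulop x) \<le> onorm (mulop (star x))" for x :: "'a unitization"
  proof -
    have "mulop (star x * x) = mulop (star x) \<circ> mulop x" by (simp add: mulop_simps fun_eq_iff)
    then have "onorm (mulop (star x * x)) \<le> onorm (mulop (star x)) * onorm (mulop x)"
      by (simp add: onorm_compose bounded_linear_mulop)
    with op[of x] have "onorm (mulop x) * onorm (mulop x) \<le> onorm (mulop (star x)) * onorm (mulop x)"
      by (simp add: power2_eq_square)
    then show ?thesis
      using onorm_pos_le[OF bounded_linear_mulop, of x] onorm_pos_le[OF bounded_linear_mulop, of "star x"]
      by (metis mult_right_le_imp_le order_le_less)
  qed
  have "norm (star x) \<le> norm x"
    using op_star[of "star x"]
    by (simp add: norm_unitization_def star_unitization_def star_star)
  then have "norm (star x * x) \<le> norm x ^ 2"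
    using norm_mult_ineq[of "star x" x] mult_right_mono[of "norm (star x)" "norm x" "norm x"]
    by (simp add: power2_eq_square)
  moreover have "norm x ^ 2 \<le> norm (star x * x)"
  \<comment> \<open>The maximum is attained by one of the two seminorms, and each satisfies the
    inequality on its own.\<close>
  proof (cases "cmod (scal x) \<le> onorm (mulop x)")
    case True
    then show ?thesis
      using op[of x] norm_mulop_le[of "star x * x"] by (simp add: norm_unitization_def[of x])
  next
    case False
    have "cmod (scal (star x * x)) = cmod (scal x) ^ 2"
      by (simp add: star_unitization_def norm_mult power2_eq_square)
    with False norm_scal_le[of "star x * x"] show ?thesis by (simp add: norm_unitization_def[of x])
  qed
  ultimately show "norm (star x * x) = (norm x)\<^sup>2" by (rule antisym)
qed

end

lemma base_scaleC [simp]: "base (c *\<^sub>C x) = c *\<^sub>C base x"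
  and scal_scaleC [simp]: "scal (c *\<^sub>C x) = c * scal x"
  by (simp_all add: scaleC_unitization_def)

subsection \<open>Normalised local cocycles\<close>

lemma clinear_compose: "clinear f \<Longrightarrow> clinear g \<Longrightarrow> clinear (\<lambda>x. f (g x))"
  by (rule clinearI) (simp_all add: clinear_add clinear_scaleC)

lemma clinear_fun_diff: "clinear f \<Longrightarrow> clinear g \<Longrightarrow> clinear (\<lambda>x. f x - g x)"
  by (rule clinearI)
    (simp_all add: clinear_add clinear_scaleC algebra_simps scaleC.scale_right_diff_distrib)

lemma clinear_mult_left: "clinear (\<lambda>x. c * x :: 'a::complex_banach_algebra)"
  by (rule clinearI) (simp_all add: distrib_left scaleC_mult_right)

lemma clinear_mult_right: "clinear (\<lambda>x. x * c :: 'a::complex_banach_algebra)"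
  by (rule clinearI) (simp_all add: distrib_right scaleC_mult_left)

lemma multilinearD:
  "multilinear n T \<Longrightarrow> length a = n \<Longrightarrow> i < n \<Longrightarrow> clinear (\<lambda>b. T (a[i := b]))"
  by (simp add: multilinear_def)

lemma multilinear_middle:
  assumes "multilinear n T" "length xs + length ys + 1 = n"
  shows "clinear (\<lambda>b. T (xs @ b # ys))"
  \<comment> \<open>\<open>undefined\<close> merely holds the slot that the list update
    overwrites.\<close>
  using multilinearD[OF assms(1), of "xs @ undefined # ys" "length xs"] assms(2) by simp

lemma multilinear_zero:
  assumes "multilinear n T" "length xs = n" "0 \<in> set xs"
  shows "T xs = 0"
proof -
  obtain ys zs where xs: "xs = ys @ 0 # zs" using split_list[OF assms(3)] by blast
  show ?thesis
    using clinear_zero[OF multilinear_middle[OF assms(1), of ys zs]] assms(2) by (simp add: xs)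
qed

lemma multilinear_Cons:
  fixes T :: "'a::complex_normed_vector list \<Rightarrow> 'x::complex_normed_vector"
  shows "multilinear (Suc n) T \<longleftrightarrow> (\<forall>xs. length xs = n \<longrightarrow> clinear (\<lambda>b. T (b # xs)))
     \<and> (\<forall>b. multilinear n (\<lambda>xs. T (b # xs)))"
proof (intro iffI conjI allI impI)
  fix xs :: "'a list" assume "multilinear (Suc n) T" "length xs = n"
  then show "clinear (\<lambda>b. T (b # xs))" using multilinear_middle[of "Suc n" T "[]" xs] by simp
next
  fix b assume T: "multilinear (Suc n) T"
  show "multilinear n (\<lambda>xs. T (b # xs))"
    unfolding multilinear_def
  proof (intro allI impI)
    fix a :: "'a list" and i assume "length a = n" "i < n"
    then show "clinear (\<lambda>c. T (b # a[i := c]))"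
      using multilinearD[OF T, of "b # a" "Suc i"] by simp
  qed
next
  assume T: "(\<forall>xs. length xs = n \<longrightarrow> clinear (\<lambda>b. T (b # xs)))
     \<and> (\<forall>b. multilinear n (\<lambda>xs. T (b # xs)))"
  show "multilinear (Suc n) T"
    unfolding multilinear_def
  proof (intro allI impI)
    fix a :: "'a list" and i assume a: "length a = Suc n" "i < Suc n"
    then obtain b xs where [simp]: "a = b # xs" and "length xs = n" by (cases a) auto
    with T a show "clinear (\<lambda>c. T (a[i := c]))"
      by (cases i) (auto dest: multilinearD)
  qed
qed

lemma multilinear_snoc:
  assumes "\<And>xs. length xs = n \<Longrightarrow> clinear (\<lambda>b. T (xs @ [b]))"
    and "\<And>b. multilinear n (\<lambda>xs. T (xs @ [b]))"
  shows "multilinear (Suc n) T"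
  unfolding multilinear_def
proof (intro allI impI)
  fix a :: "'a list" and i assume a: "length a = Suc n" "i < Suc n"
  then obtain b xs where [simp]: "a = xs @ [b]" and xs: "length xs = n"
    by (cases a rule: rev_cases) auto
  show "clinear (\<lambda>c. T (a[i := c]))"
  proof (cases "i < n")
    case True
    then show ?thesis using multilinearD[OF assms(2) xs True] by (simp add: list_update_append xs)
  next
    case False
    with a have "i = n" by simp
    then show ?thesis using assms(1)[OF xs] by (simp add: xs[symmetric])
  qed
qed

lemma multilinear_fun_diff:
  "multilinear n S \<Longrightarrow> multilinear n T \<Longrightarrow> multilinear n (\<lambda>xs. S xs - T xs)"
  by (simp add: multilinear_def clinear_fun_diff)

lemma multilinear_compose: "clinear f \<Longrightarrow> multilinear n T \<Longrightarrow> multilinear n (\<lambda>xs. f (T xs))"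
  by (simp add: multilinear_def clinear_compose[of f])

lemma prod_nth_conv_prod_list: "(\<Prod>i<length xs. f (xs ! i)) = prod_list (map f xs)"
  by (induction xs) (simp_all add: prod.lessThan_Suc_shift del: prod.lessThan_Suc)

text \<open>In this form, with a nonnegative constant and \<open>prod_list\<close>, estimates can
  split off arguments along \<open>Cons\<close>.\<close>

lemma bounded_multilinear_iff:
  "bounded_multilinear n T \<longleftrightarrow> multilinear n T \<and>
     (\<exists>K\<ge>0. \<forall>xs. length xs = n \<longrightarrow> norm (T xs) \<le> K * prod_list (map norm xs))"
proof -
  have nonneg: "0 \<le> prod_list (map norm xs)" for xs :: "'a list" by (induction xs) auto
  have "\<exists>K\<ge>0. \<forall>xs. length xs = n \<longrightarrow> norm (T xs) \<le> K * prod_list (map norm xs)"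
    if "\<forall>xs. length xs = n \<longrightarrow> norm (T xs) \<le> K * prod_list (map norm xs)" for K
    using that by (intro exI[of _ "\<bar>K\<bar>"]) (auto intro: order_trans[OF _ mult_right_mono[OF abs_ge_self nonneg]])
  then show ?thesis
    unfolding bounded_multilinear_def by (auto simp flip: prod_nth_conv_prod_list)
qed

section \<open>Sliding factors across junctions\<close>

text \<open>The failure of \<open>c\<close> to slide across the first junction of \<open>G (1, x, \<dots>)\<close>.\<close>

definition slide :: "'a::{cstar_algebra,real_normed_algebra_1} \<Rightarrow>
    ('a list \<Rightarrow> 'x::complex_normed_vector) \<Rightarrow> 'a list \<Rightarrow> 'x" where
  "slide c G xs = G (c # xs) - G (1 # c * hd xs # tl xs)"

lemma bounded_multilinear_slide:
  assumes "bounded_multilinear (Suc (Suc n)) G"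
  shows "bounded_multilinear (Suc n) (slide c G)"
  unfolding bounded_multilinear_iff
proof (intro conjI)
  have G: "multilinear (Suc (Suc n)) G" using assms by (simp add: bounded_multilinear_iff)
  then have G1: "multilinear (Suc n) (\<lambda>xs. G (b # xs))" for b by (simp add: multilinear_Cons)
  show "multilinear (Suc n) (slide c G)"
    unfolding multilinear_Cons slide_def list.sel
    using G1 by (auto intro!: clinear_fun_diff multilinear_fun_diff
        clinear_compose[OF _ clinear_mult_left] simp: multilinear_Cons)
  obtain K where K: "0 \<le> K" "\<And>xs. length xs = Suc (Suc n) \<Longrightarrow> norm (G xs) \<le> K * prod_list (map norm xs)"
    using assms by (auto simp: bounded_multilinear_iff)
  show "\<exists>K\<ge>0. \<forall>xs. length xs = Suc n \<longrightarrow> norm (slide c G xs) \<le> K * prod_list (map norm xs)"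
  proof (intro exI[of _ "2 * K * norm c"] conjI allI impI)
    fix xs :: "'a list" assume "length xs = Suc n"
    then obtain b ys where [simp]: "xs = b # ys" and ys: "length ys = n" by (cases xs) auto
    have nonneg: "0 \<le> prod_list (map norm ys)" by (induction ys) auto
    have "norm (G (1 # c * b # ys)) \<le> K * (norm (c * b) * prod_list (map norm ys))"
      using K(2)[of "1 # c * b # ys"] ys by simp
    also have "\<dots> \<le> K * (norm c * norm b * prod_list (map norm ys))"
      by (intro mult_left_mono mult_right_mono norm_mult_ineq K nonneg)
    finally have "norm (slide c G xs) \<le> K * (norm c * (norm b * prod_list (map norm ys)))
        + K * (norm c * norm b * prod_list (map norm ys))"
      using K(2)[of "c # b # ys"] ys unfolding slide_def
      by (intro order_trans[OF norm_triangle_ineq4] add_mono) simp_all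
    then show "norm (slide c G xs) \<le> 2 * K * norm c * prod_list (map norm xs)"
      by (simp add: algebra_simps)
  qed (simp add: K)
qed

abbreviation zero_chain :: "'a::{times,zero} list \<Rightarrow> bool" where
  "zero_chain \<equiv> successively (\<lambda>a b. a * b = 0)"

text \<open>With b and ys fixed, consider \<open>\<phi> f g = G (f # g * b # ys)\<close>. If f g =
  0, its argument is again a zero chain: f (g b) = 0, and g b still annihilates the next entry. So
  \<open>\<phi>\<close> vanishes on zero products, and \<open>\<phi> c 1 = \<phi> 1 c\<close> is the
  claim.\<close>

lemma slide_zero_chain:
  assumes G: "bounded_multilinear (Suc (Suc n)) G"
    and zero: "\<And>xs. length xs = Suc (Suc n) \<Longrightarrow> zero_chain xs \<Longrightarrow> G xs = 0"
    and xs: "length xs = Suc n" "zero_chain xs"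
  shows "slide c G xs = 0"
proof -
  from xs obtain b ys where [simp]: "xs = b # ys" and ys: "length ys = n" by (cases xs) auto
  define \<phi> where "\<phi> f g = G (f # g * b # ys)" for f g
  have ml: "multilinear (Suc (Suc n)) G" using G by (simp add: bounded_multilinear_iff)
  then have lin1: "clinear (\<lambda>f. \<phi> f g)" for g
    by (simp add: \<phi>_def multilinear_Cons ys)
  from ml have "clinear (\<lambda>g. G (f # g # ys))" for f
    by (simp add: multilinear_Cons ys)
  then have lin2: "clinear (\<phi> f)" for f
    unfolding \<phi>_def by (intro clinear_compose[OF _ clinear_mult_right])
  obtain K where K: "0 \<le> K" "\<And>xs. length xs = Suc (Suc n) \<Longrightarrow> norm (G xs) \<le> K * prod_list (map norm xs)"
    using G by (auto simp: bounded_multilinear_iff)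
  let ?p = "prod_list (map norm ys)"
  have nonneg: "0 \<le> ?p" by (induction ys) auto
  have "bounded_bilinear \<phi>"
  proof
    show "\<exists>K. \<forall>f g. norm (\<phi> f g) \<le> norm f * norm g * K"
    proof (intro exI[of _ "K * norm b * ?p"] allI)
      fix f g
      have "norm (\<phi> f g) \<le> K * (norm f * (norm (g * b) * ?p))"
        using K(2)[of "f # g * b # ys"] ys by (simp add: \<phi>_def)
      also have "\<dots> \<le> K * (norm f * (norm g * norm b * ?p))"
        by (intro mult_left_mono mult_right_mono norm_mult_ineq K nonneg norm_ge_zero)
      finally show "norm (\<phi> f g) \<le> norm f * norm g * (K * norm b * ?p)" by (simp add: algebra_simps)
    qed
  qed (simp_all add: clinear_add[OF lin1] clinear_add[OF lin2] clinear_scaleR[OF lin1] clinear_scaleR[OF lin2])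
  moreover have "\<phi> f g = 0" if "f * g = 0" for f g
    unfolding \<phi>_def
  proof (rule zero)
    have "f * (g * b) = 0" using that by (metis mult.assoc mult_zero_left)
    moreover have "g * b * hd ys = 0" if "ys \<noteq> []"
      using xs(2) that by (simp add: successively_Cons mult.assoc)
    ultimately show "zero_chain (f # g * b # ys)"
      using xs(2) by (auto simp: successively_Cons)
  qed (simp add: ys)
  ultimately have "\<phi> c 1 = \<phi> 1 c" using lin2 lin1 by (rule zero_product_commute)
  then show ?thesis by (simp add: slide_def \<phi>_def)
qed

text \<open>A slide consumes one argument and preserves both boundedness and vanishing on zero
  chains. Once a single argument is left, the chain condition is void.\<close>

lemma fold_slide_zero_chain:
  assumes "bounded_multilinear (length cs + Suc n) G"
    and "\<And>xs. length xs = length cs + Suc n \<Longrightarrow> zero_chain xs \<Longrightarrow> G xs = 0"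
    and "length xs = Suc n" "zero_chain xs"
  shows "fold slide cs G xs = 0"
  using assms
proof (induction cs arbitrary: G)
  case (Cons c cs)
  have "fold slide cs (slide c G) xs = 0"
  proof (rule Cons.IH)
    show "bounded_multilinear (length cs + Suc n) (slide c G)"
      using bounded_multilinear_slide[of "length cs + n" G c] Cons.prems(1) by simp
    show "slide c G ys = 0" if "length ys = length cs + Suc n" "zero_chain ys" for ys
      using slide_zero_chain[of "length cs + n" G ys c] Cons.prems(1,2) that by simp
  qed (use Cons.prems in auto)
  then show ?case by simp
qed simp

text \<open>Interpolates between the left-action term alone (k = 0) and the whole coboundary without
  its right-action term (k = n); k counts the junctions already slid across.\<close>

definition partial_coboundary ::
    "('a::complex_banach_algebra \<Rightarrow> 'x::complex_banach \<Rightarrow> 'x) \<Rightarrow> ('a list \<Rightarrow> 'x) \<Rightarrow> nat \<Rightarrow> 'a list \<Rightarrow> 'x" where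
  "partial_coboundary lact T k a =
     lact (a ! 0) (T (drop 1 a))
     + (\<Sum>j=1..k. (- 1) ^ j *\<^sub>R T (take (j - 1) a @ [a ! (j - 1) * a ! j] @ drop (j + 1) a))"

lemma coboundary_eq_partial:
  "coboundary lact ract n T a =
     partial_coboundary lact T n a + (- 1) ^ (n + 1) *\<^sub>R ract (T (take n a)) (a ! n)"
  by (simp add: coboundary_def partial_coboundary_def)

lemma bimodule_simps:
  assumes "banach_bimodule lact ract"
  shows "lact a (x + y) = lact a x + lact a y" "lact a (x - y) = lact a x - lact a y"
    "lact a 0 = 0" "lact 0 x = 0" "lact (a + b) x = lact a x + lact b x"
    "ract (x + y) a = ract x a + ract y a" "ract (x - y) a = ract x a - ract y a"
    "ract 0 a = 0" "ract x 0 = 0" "ract x (a + b) = ract x a + ract x b"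
    "lact (c *\<^sub>C a) x = c *\<^sub>C lact a x" "lact a (c *\<^sub>C x) = c *\<^sub>C lact a x"
    "ract (c *\<^sub>C x) a = c *\<^sub>C ract x a" "ract x (c *\<^sub>C a) = c *\<^sub>C ract x a"
    "lact a (r *\<^sub>R x) = r *\<^sub>R lact a x" "ract (r *\<^sub>R x) a = r *\<^sub>R ract x a"
proof -
  interpret banach_bimodule lact ract by (rule assms)
  show "lact a (x + y) = lact a x + lact a y" "lact a (x - y) = lact a x - lact a y"
    "lact a 0 = 0" "lact 0 x = 0" "lact (a + b) x = lact a x + lact b x"
    "ract (x + y) a = ract x a + ract y a" "ract (x - y) a = ract x a - ract y a"
    "ract 0 a = 0" "ract x 0 = 0" "ract x (a + b) = ract x a + ract x b"
    "lact (c *\<^sub>C a) x = c *\<^sub>C lact a x" "lact a (c *\<^sub>C x) = c *\<^sub>C lact a x"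
    "ract (c *\<^sub>C x) a = c *\<^sub>C ract x a" "ract x (c *\<^sub>C a) = c *\<^sub>C ract x a"
    "lact a (r *\<^sub>R x) = r *\<^sub>R lact a x" "ract (r *\<^sub>R x) a = r *\<^sub>R ract x a"
    by (rule clinear_add[OF clinear_lact(1)] clinear_add[OF clinear_lact(2)]
        clinear_diff[OF clinear_lact(1)] clinear_zero[OF clinear_lact(1)] clinear_zero[OF clinear_lact(2)]
        clinear_add[OF clinear_ract(1)] clinear_add[OF clinear_ract(2)]
        clinear_diff[OF clinear_ract(2)] clinear_zero[OF clinear_ract(1)] clinear_zero[OF clinear_ract(2)]
        clinear_scaleC[OF clinear_lact(1)] clinear_scaleC[OF clinear_lact(2)]
        clinear_scaleC[OF clinear_ract(1)] clinear_scaleC[OF clinear_ract(2)]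
        clinear_scaleR[OF clinear_lact(1)] clinear_scaleR[OF clinear_ract(2)])+
qed

text \<open>Let k be the position of the inserted 1. If k > 0, every term before the k-th still has
  1 as an argument and vanishes, while the k-th absorbs it into the last entry of \<open>cs\<close>;
  if k = 0, the left action absorbs it. The following term of the coboundary would cancel the
  result, but the partial sum stops before it.\<close>

lemma partial_coboundary_insert_one:
  fixes T :: "'a::{cstar_algebra,real_normed_algebra_1} list \<Rightarrow> 'x::complex_banach"
  assumes normalised: "\<And>xs. length xs = n \<Longrightarrow> 1 \<in> set xs \<Longrightarrow> T xs = 0"
    and bimodule: "banach_bimodule lact ract" and unital: "\<And>x. lact 1 x = x"
    and n: "length cs + length zs = n"
  shows "partial_coboundary lact T (length cs) (cs @ 1 # zs) = (- 1) ^ length cs *\<^sub>R T (cs @ zs)"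
proof (cases "length cs")
  case 0
  then show ?thesis by (simp add: partial_coboundary_def unital)
next
  case (Suc k)
  let ?L = "cs @ 1 # zs"
  let ?t = "\<lambda>j. (- 1) ^ j *\<^sub>R T (take (j - 1) ?L @ [?L ! (j - 1) * ?L ! j] @ drop (j + 1) ?L)"
  have "T (drop 1 ?L) = 0" using n Suc by (intro normalised) (auto simp: Suc)
  moreover have "?t j = 0" if "j \<in> {1..k}" for j
  proof -
    have "1 \<in> set (drop (j + 1) ?L)" using that Suc by auto
    then have "1 \<in> set (take (j - 1) ?L @ [?L ! (j - 1) * ?L ! j] @ drop (j + 1) ?L)" by simp
    moreover have "length (take (j - 1) ?L @ [?L ! (j - 1) * ?L ! j] @ drop (j + 1) ?L) = n"
      using that Suc n by auto
    ultimately show ?thesis using normalised by simp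
  qed
  moreover have "(\<Sum>j=1..Suc k. ?t j) = (\<Sum>j=1..k. ?t j) + ?t (Suc k)" by simp
  moreover have "take k ?L @ [?L ! k * ?L ! Suc k] @ drop (Suc k + 1) ?L = cs @ zs"
  proof -
    have "?L ! k * ?L ! Suc k = cs ! k" using Suc by (simp add: nth_append)
    moreover have "take k cs @ [cs ! k] = cs"
      using Suc take_Suc_conv_app_nth[of k cs] by simp
    ultimately show ?thesis using Suc by simp
  qed
  ultimately show ?thesis
    unfolding partial_coboundary_def Suc by (simp only: bimodule_simps[OF bimodule] sum.neutral) simp
qed

text \<open>By \<open>partial_coboundary_insert_one\<close> the expression subtracted by a slide is
  a single value of \<open>T\<close>, namely the next contraction term up to sign. Induction is from
  the right because the last slide of a \<open>fold\<close> is the outermost.\<close>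

lemma fold_slide_partial_coboundary:
  fixes T :: "'a::{cstar_algebra,real_normed_algebra_1} list \<Rightarrow> 'x::complex_banach"
  assumes bimodule: "banach_bimodule lact ract" and unital: "\<And>x. lact 1 x = x"
    and normalised: "\<And>xs. length xs = n \<Longrightarrow> 1 \<in> set xs \<Longrightarrow> T xs = 0"
    and "length cs \<le> n" "length cs + length xs = n + 2"
  shows "fold slide cs (\<lambda>xs. ract (partial_coboundary lact T 0 (butlast xs)) (last xs)) xs
    = ract (partial_coboundary lact T (length cs) (cs @ butlast xs)) (last xs)"
  using assms(4,5)
proof (induction cs arbitrary: xs rule: rev_induct)
  case (snoc c cs)
  let ?D = "partial_coboundary lact T"
  \<comment> \<open>At least two arguments remain, so \<open>b\<close> is not the last one, which
    acts from the right.\<close>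
  from snoc.prems obtain b y ys where xs: "xs = b # y # ys"
    by (cases xs; cases "tl xs") auto
  let ?zs = "butlast (y # ys)"
  have n: "length cs + length ?zs + 1 = n" using snoc.prems by (simp add: xs del: butlast.simps)
  have "?D (Suc (length cs)) (cs @ c # b # ?zs)
      = ?D (length cs) (cs @ c # b # ?zs) - (- 1) ^ length cs *\<^sub>R T (cs @ c * b # ?zs)"
    by (simp add: partial_coboundary_def nth_append)
  also have "(- 1) ^ length cs *\<^sub>R T (cs @ c * b # ?zs) = ?D (length cs) (cs @ 1 # c * b # ?zs)"
    using n by (intro partial_coboundary_insert_one[symmetric, OF normalised bimodule unital]) auto
  finally have "?D (Suc (length cs)) (cs @ c # b # ?zs)
      = ?D (length cs) (cs @ c # b # ?zs) - ?D (length cs) (cs @ 1 # c * b # ?zs)" .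
  then show ?case
    using snoc.prems snoc.IH[of "c # xs"] snoc.IH[of "1 # c * b # y # ys"]
    by (simp add: slide_def xs bimodule_simps[OF bimodule])
qed simp

lemma local_cocycle_zero_chain:
  assumes bimodule: "banach_bimodule lact ract" and T: "local_cocycle lact ract n T"
    and xs: "length xs = n + 2" "zero_chain xs"
  shows "ract (partial_coboundary lact T 0 (butlast xs)) (last xs) = 0"
proof -
  interpret banach_bimodule lact ract by (rule bimodule)
  define a where "a = butlast xs"
  have a: "length a = n + 1" using xs by (simp add: a_def)
  \<comment> \<open>The witness is taken at a_1, ..., a_n, the only tuple at which the goal
    evaluates \<open>T\<close>.\<close>
  from T a obtain S where S: "cocycle lact ract n S" "T (drop 1 a) = S (drop 1 a)"
    unfolding local_cocycle_def by (metis add_diff_cancel_right' length_drop)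
  have nth: "a ! i = xs ! i" if "i < n + 1" for i
    using that a unfolding a_def by (simp add: nth_butlast)
  have chain: "xs ! i * xs ! Suc i = 0" if "i < n + 1" for i
    using successively_nth[OF xs(2), of i] that xs(1) by simp
  have "S (take (j - 1) a @ [a ! (j - 1) * a ! j] @ drop (j + 1) a) = 0" if "j \<in> {1..n}" for j
  proof (rule multilinear_zero)
    show "multilinear n S" using S by (simp add: cocycle_def)
    show "length (take (j - 1) a @ [a ! (j - 1) * a ! j] @ drop (j + 1) a) = n" using that a by auto
    show "0 \<in> set (take (j - 1) a @ [a ! (j - 1) * a ! j] @ drop (j + 1) a)"
    proof -
      have "a ! (j - 1) * a ! j = 0" using that chain[of "j - 1"] nth[of "j - 1"] nth[of j] by auto
      then show ?thesis by simp
    qed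
  qed
  moreover have "coboundary lact ract n S a = 0" using S a by (simp add: cocycle_def)
  ultimately have "lact (a ! 0) (S (drop 1 a)) = - ((- 1) ^ (n + 1) *\<^sub>R ract (S (take n a)) (a ! n))"
    by (simp add: coboundary_def eq_neg_iff_add_eq_0)
  also have "\<dots> = (- ((- 1) ^ (n + 1))) *\<^sub>R ract (S (take n a)) (a ! n)" by simp
  finally have "ract (lact (a ! 0) (S (drop 1 a))) (last xs)
      = (- ((- 1) ^ (n + 1))) *\<^sub>R ract (S (take n a)) (a ! n * last xs)"
    by (simp only: bimodule_simps[OF bimodule] ract_mult)
  moreover have "a ! n * last xs = 0"
  proof -
    have "last xs = xs ! Suc n" using xs(1) by (subst last_conv_nth) auto
    then show ?thesis using chain[of n] nth[of n] by simp
  qed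
  ultimately show ?thesis
    using S by (simp add: partial_coboundary_def a_def[symmetric] bimodule_simps[OF bimodule])
qed

lemma bounded_multilinear_actions:
  assumes bimodule: "banach_bimodule lact ract" and T: "bounded_multilinear n T"
  shows "bounded_multilinear (n + 2) (\<lambda>xs. ract (partial_coboundary lact T 0 (butlast xs)) (last xs))"
  unfolding bounded_multilinear_iff
proof (intro conjI)
  interpret banach_bimodule lact ract by (rule bimodule)
  have ml: "multilinear n T" using T by (simp add: bounded_multilinear_iff)
  have D: "multilinear (Suc n) (partial_coboundary lact T 0)"
    by (simp add: multilinear_Cons partial_coboundary_def multilinear_compose clinear_lact ml)
  have "multilinear (Suc (Suc n)) (\<lambda>xs. ract (partial_coboundary lact T 0 (butlast xs)) (last xs))"
    by (rule multilinear_snoc) (simp_all add: clinear_ract multilinear_compose[OF clinear_ract(2)] D)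
  then show "multilinear (n + 2) (\<lambda>xs. ract (partial_coboundary lact T 0 (butlast xs)) (last xs))"
    by simp
  obtain K where K: "0 \<le> K" "\<And>xs. length xs = n \<Longrightarrow> norm (T xs) \<le> K * prod_list (map norm xs)"
    using T by (auto simp: bounded_multilinear_iff)
  obtain L where L: "0 \<le> L" "\<And>a x. norm (lact a x) \<le> norm a * norm x * L"
    using bounded_bilinear.nonneg_bounded[OF bounded_bilinear_lact] by blast
  obtain R where R: "0 \<le> R" "\<And>x a. norm (ract x a) \<le> norm x * norm a * R"
    using bounded_bilinear.nonneg_bounded[OF bounded_bilinear_ract] by blast
  show "\<exists>K\<ge>0. \<forall>xs. length xs = n + 2 \<longrightarrow>
      norm (ract (partial_coboundary lact T 0 (butlast xs)) (last xs)) \<le> K * prod_list (map norm xs)"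
  proof (intro exI[of _ "K * L * R"] conjI allI impI)
    fix xs :: "'a list" assume len: "length xs = n + 2"
    then obtain a zs where a: "xs = a # zs" "length zs = Suc n" by (cases xs) auto
    then obtain ys b where [simp]: "xs = a # ys @ [b]" and ys: "length ys = n"
      by (cases zs rule: rev_cases) auto
    have "norm (ract (lact a (T ys)) b) \<le> norm (lact a (T ys)) * norm b * R" by (rule R)
    also have "\<dots> \<le> (norm a * norm (T ys) * L) * norm b * R"
      by (intro mult_right_mono L R norm_ge_zero)
    also have "\<dots> \<le> (norm a * (K * prod_list (map norm ys)) * L) * norm b * R"
      by (intro mult_right_mono mult_left_mono L R norm_ge_zero K ys)
    finally show "norm (ract (partial_coboundary lact T 0 (butlast xs)) (last xs))
        \<le> K * L * R * prod_list (map norm xs)"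
      by (simp add: partial_coboundary_def butlast_append mult_ac)
  qed (simp add: K L R)
qed

text \<open>The first n slides assemble the left-action term and all contractions; the slide across
  the last junction supplies the right-action term.\<close>

theorem normalised_local_cocycle:
  fixes T :: "'a::{cstar_algebra,real_normed_algebra_1} list \<Rightarrow> 'x::complex_banach"
  assumes bimodule: "banach_bimodule lact ract"
    and unital: "\<And>x. lact 1 x = x" "\<And>x. ract x 1 = x"
    and T: "bounded_local_cocycle lact ract n T"
    and normalised: "\<And>xs. length xs = n \<Longrightarrow> 1 \<in> set xs \<Longrightarrow> T xs = 0"
    and a: "length a = n + 1"
  shows "coboundary lact ract n T a = 0"
proof -
  let ?F = "\<lambda>xs. ract (partial_coboundary lact T 0 (butlast xs)) (last xs)"
  let ?D = "partial_coboundary lact T n"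
  from a obtain cs c where [simp]: "a = cs @ [c]" and cs: "length cs = n"
    by (cases a rule: rev_cases) auto
  \<comment> \<open>F has n + 2 arguments: n + 1 slides use up \<open>a\<close>, and the remaining
    argument 1 lets the right action drop out.\<close>
  have "fold slide a ?F [1] = 0"
  proof (rule fold_slide_zero_chain)
    show "bounded_multilinear (length a + Suc 0) ?F"
      using bounded_multilinear_actions[OF bimodule] T a by (simp add: bounded_local_cocycle_def)
    show "?F xs = 0" if "length xs = length a + Suc 0" "zero_chain xs" for xs
      using local_cocycle_zero_chain[OF bimodule, where n = n and T = T and xs = xs] T a that by (simp add: bounded_local_cocycle_def)
  qed simp_all
  \<comment> \<open>The final slide is expanded by hand: it crosses into the argument of the right
    action.\<close>
  moreover have "fold slide a ?F [1] = fold slide cs ?F [c, 1] - fold slide cs ?F [1, c]"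
    by (simp add: slide_def)
  moreover
  have "fold slide cs ?F xs = ract (?D (cs @ butlast xs)) (last xs)" if "length xs = 2" for xs
  proof -
    have "fold slide cs ?F xs
        = ract (partial_coboundary lact T (length cs) (cs @ butlast xs)) (last xs)"
      by (rule fold_slide_partial_coboundary[OF bimodule unital(1), where n = n])
        (use normalised cs that in auto)
    then show ?thesis by (simp add: cs)
  qed
  then have "fold slide cs ?F [c, 1] = ?D a" "fold slide cs ?F [1, c] = ract (?D (cs @ [1])) c"
    by (simp_all add: unital)
  moreover have "?D (cs @ [1]) = (- 1) ^ n *\<^sub>R T cs"
  proof -
    have "partial_coboundary lact T (length cs) (cs @ 1 # []) = (- 1) ^ length cs *\<^sub>R T (cs @ [])"
      by (rule partial_coboundary_insert_one[OF _ bimodule unital(1), where n = n])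
        (use normalised cs in auto)
    then show ?thesis by (simp add: cs)
  qed
  ultimately have "?D a - (- 1) ^ n *\<^sub>R ract (T cs) c = 0"
    by (simp add: bimodule_simps[OF bimodule])
  then show ?thesis using cs by (simp add: coboundary_eq_partial nth_append)
qed

subsection \<open>Reduction to the unital case\<close>

definition unit_lact :: "('a \<Rightarrow> 'x \<Rightarrow> 'x) \<Rightarrow> 'a unitization \<Rightarrow> 'x \<Rightarrow> 'x::complex_normed_vector" where
  "unit_lact lact a x = lact (base a) x + scal a *\<^sub>C x"

definition unit_ract :: "('x \<Rightarrow> 'a \<Rightarrow> 'x) \<Rightarrow> 'x \<Rightarrow> 'a unitization \<Rightarrow> 'x::complex_normed_vector" where
  "unit_ract ract x a = ract x (base a) + scal a *\<^sub>C x"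

lemma banach_bimodule_unitization:
  fixes lact :: "'a::cstar_algebra \<Rightarrow> 'x::complex_banach \<Rightarrow> 'x"
  assumes "banach_bimodule lact ract"
  shows "banach_bimodule (unit_lact lact) (unit_ract ract)"
proof -
  interpret banach_bimodule lact ract by (rule assms)
  note simps = bimodule_simps[OF assms]
  show ?thesis
  proof (rule banach_bimodule.intro)
    obtain L where L: "0 \<le> L" "\<And>a x. norm (lact a x) \<le> norm a * norm x * L"
      using bounded_bilinear.nonneg_bounded[OF bounded_bilinear_lact] by blast
    obtain R where R: "0 \<le> R" "\<And>x a. norm (ract x a) \<le> norm x * norm a * R"
      using bounded_bilinear.nonneg_bounded[OF bounded_bilinear_ract] by blast
    show "bounded_bilinear (unit_lact lact)"
    proof
      show "\<exists>K. \<forall>a x. norm (unit_lact lact a x) \<le> norm a * norm x * K"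
      proof (intro exI[of _ "2 * L + 1"] allI)
        fix a :: "'a unitization" and x :: 'x
        have "norm (lact (base a) x) \<le> (2 * norm a) * norm x * L"
          by (rule order_trans[OF L(2)]) (intro mult_right_mono norm_base_le L norm_ge_zero)
        moreover have "norm (scal a *\<^sub>C x) \<le> norm a * norm x"
          by (simp add: norm_scaleC mult_right_mono norm_scal_le)
        ultimately show "norm (unit_lact lact a x) \<le> norm a * norm x * (2 * L + 1)"
          unfolding unit_lact_def
          by (intro order_trans[OF norm_triangle_ineq]) (simp add: algebra_simps)
      qed
    qed (simp_all add: unit_lact_def simps scaleC_add_left scaleC_add_right algebra_simps
        scaleC_scaleR_commute clinear_scaleR[OF clinear_lact(2)] scaleR_conv_of_real[where 'a = complex]
        scaleC_of_real[symmetric])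
    show "bounded_bilinear (unit_ract ract)"
    proof
      show "\<exists>K. \<forall>x a. norm (unit_ract ract x a) \<le> norm x * norm a * K"
      proof (intro exI[of _ "2 * R + 1"] allI)
        fix a :: "'a unitization" and x :: 'x
        have "norm (ract x (base a)) \<le> norm x * (2 * norm a) * R"
          by (rule order_trans[OF R(2)]) (intro mult_right_mono mult_left_mono norm_base_le R norm_ge_zero)
        moreover have "norm (scal a *\<^sub>C x) \<le> norm a * norm x"
          by (simp add: norm_scaleC mult_right_mono norm_scal_le)
        ultimately show "norm (unit_ract ract x a) \<le> norm x * norm a * (2 * R + 1)"
          unfolding unit_ract_def
          by (intro order_trans[OF norm_triangle_ineq]) (simp add: algebra_simps)
      qed
    qed (simp_all add: unit_ract_def simps scaleC_add_left scaleC_add_right algebra_simps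
        scaleC_scaleR_commute clinear_scaleR[OF clinear_ract(1)] scaleR_conv_of_real[where 'a = complex]
        scaleC_of_real[symmetric])
    fix a b :: "'a unitization" and x :: 'x
    show "clinear (unit_lact lact a)" "clinear (\<lambda>a. unit_lact lact a x)"
      by (rule clinearI; simp add: unit_lact_def simps scaleC_add_left scaleC_add_right algebra_simps)+
    show "clinear (unit_ract ract x)" "clinear (\<lambda>x. unit_ract ract x a)"
      by (rule clinearI; simp add: unit_ract_def simps scaleC_add_left scaleC_add_right algebra_simps)+
    show "unit_lact lact (a * b) x = unit_lact lact a (unit_lact lact b x)"
      by (simp add: unit_lact_def simps lact_mult scaleC_add_right algebra_simps)
    show "unit_ract ract x (a * b) = unit_ract ract (unit_ract ract x a) b"
      by (simp add: unit_ract_def simps ract_mult scaleC_add_right algebra_simps)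
    show "unit_ract ract (unit_lact lact a x) b = unit_lact lact a (unit_ract ract x b)"
      by (simp add: unit_lact_def unit_ract_def simps lact_ract scaleC_add_right algebra_simps)
  qed
qed

lemma bounded_multilinear_unitization:
  fixes T :: "'a::cstar_algebra list \<Rightarrow> 'x::complex_normed_vector"
  shows "multilinear n T \<Longrightarrow> multilinear n (\<lambda>xs. T (map base xs))"
    and "bounded_multilinear n T \<Longrightarrow> bounded_multilinear n (\<lambda>xs. T (map base xs))"
proof -
  have lin: "clinear (base :: 'a unitization \<Rightarrow> 'a)" by (rule clinearI) simp_all
  show ml: "multilinear n (\<lambda>xs. T (map base xs))" if "multilinear n T"
    unfolding multilinear_def map_update
    using that by (auto intro!: clinear_compose[OF _ lin] multilinearD)
  \<comment> \<open>Each application of \<open>base\<close> costs the factor 2 of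
    \<open>norm_base_le\<close>.\<close>
  have prod: "prod_list (map norm (map base xs)) \<le> 2 ^ length xs * prod_list (map norm xs)"
    for xs :: "'a unitization list"
  proof (induction xs)
    case (Cons a xs)
    have "0 \<le> prod_list (map norm (map base xs))" by (induction xs) auto
    with Cons have "norm (base a) * prod_list (map norm (map base xs))
        \<le> (2 * norm a) * (2 ^ length xs * prod_list (map norm xs))"
      by (intro mult_mono norm_base_le) auto
    then show ?case by (simp add: mult_ac)
  qed simp
  show "bounded_multilinear n (\<lambda>xs. T (map base xs))" if T: "bounded_multilinear n T"
    unfolding bounded_multilinear_iff
  proof (intro conjI)
    show "multilinear n (\<lambda>xs. T (map base xs))" using ml T by (simp add: bounded_multilinear_iff)
    obtain K where K: "0 \<le> K" "\<And>xs. length xs = n \<Longrightarrow> norm (T xs) \<le> K * prod_list (map norm xs)"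
      using T by (auto simp: bounded_multilinear_iff)
    show "\<exists>K\<ge>0. \<forall>xs. length xs = n \<longrightarrow> norm (T (map base xs)) \<le> K * prod_list (map norm xs)"
    proof (intro exI[of _ "K * 2 ^ n"] conjI allI impI)
      fix xs :: "'a unitization list" assume n: "length xs = n"
      have "norm (T (map base xs)) \<le> K * prod_list (map norm (map base xs))"
        using n by (intro K) simp
      also have "\<dots> \<le> K * (2 ^ n * prod_list (map norm xs))"
        using prod[of xs] n by (intro mult_left_mono K) simp
      finally show "norm (T (map base xs)) \<le> K * 2 ^ n * prod_list (map norm xs)"
        by (simp add: mult_ac)
    qed (simp add: K)
  qed
qed

text \<open>The scalar parts contribute \<open>\<lambda>\<^sub>i T(\<dots>)\<close> with the \<open>i\<close>-th entry omitted, once for each of the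
  two terms adjacent to position \<open>i\<close>; these contributions telescope.\<close>

lemma coboundary_unitization:
  fixes T :: "'a::cstar_algebra list \<Rightarrow> 'x::complex_banach"
  assumes bimodule: "banach_bimodule lact ract" and T: "multilinear n T" and xs: "length xs = n + 1"
  shows "coboundary (unit_lact lact) (unit_ract ract) n (\<lambda>ys. T (map base ys)) xs
    = coboundary lact ract n T (map base xs)"
proof -
  let ?a = "map base xs"
  define t where "t i = scal (xs ! i) *\<^sub>C T (take i ?a @ drop (i + 1) ?a)" for i
  \<comment> \<open>The product of a + \<lambda> and b + \<mu> has base a b + \<lambda> b + \<mu> a;
    by linearity in this slot the last two summands yield the terms omitting entry j - 1 and entry
    j.\<close>
  have "T (map base (take (j - 1) xs @ [xs ! (j - 1) * xs ! j] @ drop (j + 1) xs))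
      = T (take (j - 1) ?a @ [?a ! (j - 1) * ?a ! j] @ drop (j + 1) ?a) + (t (j - 1) + t j)"
    if j: "j \<in> {1..n}" for j
  proof -
    from j obtain i where [simp]: "j = Suc i" and i: "i < n" by (cases j) auto
    let ?u = "take (j - 1) ?a" and ?v = "drop (j + 1) ?a"
    define f where "f b = T (?u @ b # ?v)" for b
    have lin: "clinear f"
      unfolding f_def by (rule multilinear_middle[OF T]) (use i xs in auto)
    have "t (j - 1) = scal (xs ! (j - 1)) *\<^sub>C f (base (xs ! j))"
      using i xs Cons_nth_drop_Suc[of j ?a] by (simp add: t_def f_def)
    moreover have "t j = scal (xs ! j) *\<^sub>C f (base (xs ! (j - 1)))"
      using i xs take_Suc_conv_app_nth[of i ?a] by (simp add: t_def f_def)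
    moreover have "T (map base (take (j - 1) xs @ [xs ! (j - 1) * xs ! j] @ drop (j + 1) xs))
        = f (base (xs ! (j - 1)) * base (xs ! j) + scal (xs ! (j - 1)) *\<^sub>C base (xs ! j)
            + scal (xs ! j) *\<^sub>C base (xs ! (j - 1)))"
      by (simp add: take_map drop_map f_def)
    moreover have "T (take (j - 1) ?a @ [?a ! (j - 1) * ?a ! j] @ drop (j + 1) ?a)
        = f (base (xs ! (j - 1)) * base (xs ! j))"
      using i xs by (simp add: f_def)
    ultimately show ?thesis
      by (simp only: clinear_add[OF lin] clinear_scaleC[OF lin] add.assoc)
  qed
  then have sum: "(\<Sum>j=1..n. (- 1) ^ j *\<^sub>R
        T (map base (take (j - 1) xs @ [xs ! (j - 1) * xs ! j] @ drop (j + 1) xs)))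
      = (\<Sum>j=1..n. (- 1) ^ j *\<^sub>R T (take (j - 1) ?a @ [?a ! (j - 1) * ?a ! j] @ drop (j + 1) ?a))
        + (\<Sum>j=1..n. (- 1) ^ j *\<^sub>R (t (j - 1) + t j))"
    by (simp add: scaleR_add_right sum.distrib[symmetric] del: map_append)
  \<comment> \<open>The two boundary terms cancel against the scalar contributions of the left and
    the right action.\<close>
  have tele: "(\<Sum>j=1..m. (- 1) ^ j *\<^sub>R (t (j - 1) + t j)) = (- 1) ^ m *\<^sub>R t m - t 0" for m
    by (induction m) (simp_all add: algebra_simps)
  have "unit_lact lact (xs ! 0) (T (map base (drop 1 xs))) = lact (?a ! 0) (T (drop 1 ?a)) + t 0"
    using xs by (simp add: unit_lact_def t_def drop_map nth_map[of 0])
  moreover have "unit_ract ract (T (map base (take n xs))) (xs ! n) = ract (T (take n ?a)) (?a ! n) + t n"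
    using xs by (simp add: unit_ract_def t_def take_map)
  ultimately show ?thesis
    unfolding coboundary_def sum tele by (simp add: scaleR_add_right)
qed

theorem theorem4p4:
  fixes lact :: "'a::cstar_algebra \<Rightarrow> 'x::complex_banach \<Rightarrow> 'x"
    and ract :: "'x \<Rightarrow> 'a \<Rightarrow> 'x"
    and n :: nat
    and T :: "'a list \<Rightarrow> 'x"
  assumes "banach_bimodule lact ract"
    and "n \<ge> 1"
    and "bounded_local_cocycle lact ract n T"
  shows "cocycle lact ract n T"
  unfolding cocycle_def
proof (intro conjI allI impI)
  let ?T = "\<lambda>xs. T (map base xs)"
  note bimodule = assms(1)
  have T: "local_cocycle lact ract n T" "bounded_multilinear n T"
    using assms(3) by (simp_all add: bounded_local_cocycle_def)
  then show ml: "multilinear n T" by (simp add: local_cocycle_def)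
  have "local_cocycle (unit_lact lact) (unit_ract ract) n ?T"
    unfolding local_cocycle_def
  proof (intro conjI allI impI)
    show "multilinear n ?T" by (rule bounded_multilinear_unitization(1)[OF ml])
    fix xs :: "'a unitization list" assume "length xs = n"
    with T(1) obtain S where S: "cocycle lact ract n S" "T (map base xs) = S (map base xs)"
      unfolding local_cocycle_def by (metis length_map)
    then have "cocycle (unit_lact lact) (unit_ract ract) n (\<lambda>ys. S (map base ys))"
      by (simp add: cocycle_def bounded_multilinear_unitization coboundary_unitization[OF bimodule])
    with S(2) show "\<exists>S. cocycle (unit_lact lact) (unit_ract ract) n S \<and> T (map base xs) = S xs"
      by (intro exI[of _ "\<lambda>ys. S (map base ys)"]) simp
  qed
  then have local: "bounded_local_cocycle (unit_lact lact) (unit_ract ract) n ?T"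
    using bounded_multilinear_unitization(2)[OF T(2)] by (simp add: bounded_local_cocycle_def)
  \<comment> \<open>The unit has base 0.\<close>
  have normalised: "?T xs = 0" if "length xs = n" "1 \<in> set xs" for xs
  proof (rule multilinear_zero[OF ml])
    show "0 \<in> set (map base xs)" using that(2) by (force intro: image_eqI[of _ _ 1])
  qed (use that in simp)
  fix a :: "'a list" assume a: "length a = n + 1"
  \<comment> \<open>On the embedded copy of A the two coboundaries agree, since \<open>base\<close>
    recovers \<open>a\<close>.\<close>
  let ?xs = "map (\<lambda>b. Unitization b 0) a"
  have "coboundary (unit_lact lact) (unit_ract ract) n ?T ?xs = 0"
  proof (rule normalised_local_cocycle[OF banach_bimodule_unitization[OF bimodule] _ _ local normalised])
    show "unit_lact lact 1 x = x" "unit_ract ract x 1 = x" for x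
      by (simp_all add: unit_lact_def unit_ract_def bimodule_simps[OF bimodule])
  qed (use a in auto)
  then show "coboundary lact ract n T a = 0"
    using coboundary_unitization[OF bimodule ml, of ?xs] a by (simp add: comp_def)
qed

end
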